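(* Under assumptions (A1)-(A3) and (B1)-(B3) listed in the context, for every $\epsilon>0$ there exists a constant $c=c(\epsilon,Q)>0$ (with $\alpha$, $P_0$ and $f$ fixed) such that $$Q^{(n)}\left(\int \prod_{i=1}^n\frac{Pf(X_i)}{P^*f(X_i)}\,\Pi(dP)\ \geq\ c\,n^{-DK/2-(K-1)/2-\alpha/2}\right)\geq 1-\epsilon\quad\text{for every } n\ge 1.$$
   Context: Let $D\ge 1$, let $\|\cdot\|$ be the Euclidean norm, and let $f$ be a probability density on $\mathbb{R}^D$ (w.r.t. Lebesgue measure). For a probability measure $P$ on $\mathbb{R}^D$ write $Pf(x)=\int f(x-\theta)\,P(d\theta)$. Prior: $\alpha>0$, $P_0$ is a probability measure on $\Theta\subset\mathbb{R}^D$, and $\Pi$ is the law of the Dirichlet process $P\sim \mathrm{DP}(\alpha,P_0)$ in stick-breaking form, $P=\sum_{k\ge1}w_k\delta_{\theta_k}$, $w_k=v_k\prod_{j=1}^{k-1}(1-v_j)$, $v_k$ i.i.d. $\mathrm{Beta}(1,\alpha)$, $\theta_k$ i.i.d. $P_0$, the two sequences being independent. Assumptions: (A1) $X_1,X_2,\dots$ are i.i.d. from $Q(dx)=P^*f(x)\,dx$, where $P^*=\sum_{k=1}^K w_k^*\delta_{\theta_k^*}$, $K<\infty$, $(w_1^*,\dots,w_K^* )$ is a probability vector, and $P^*$ has exactly $K$ support points (the $\theta_k^*$ are distinct and $w_k^*>0$). (A2) $\Theta\subset\mathbb{R}^D$ is compact and $\theta_k^*\in\Theta$ for all $k=1,\dots,K$.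 (A3) $P_0$ has a continuous bounded density $p_0$ on $\Theta$ w.r.t. Lebesgue measure, with $p_0(\theta_k^* )>0$ for all $k=1,\dots,K$. (B1) $f\in C^3(\mathbb{R}^D)$ and there is a constant $F$ with $0<f(x)<F$ for all $x$. (B2) There are $R>0$, $\gamma\ge0$ with $\|\nabla\log f(x)\|\le R(1+\|x\|)^\gamma$ and $\|\nabla^2\log f(x)\|\le R(1+\|x\|)^\gamma$ for all $x$, and $\int e^{M\|x\|^\gamma}f(x)\,dx<\infty$ for every $M>0$. (B3) There are $C,r>0$ with $\|\nabla^g f(x)\|\le C(1+\|x\|)^{-(D+r)}$ for all $x$ and $g=1,2,3$. $Q^{(n)}=\otimes_{i=1}^nQ$ is the law of $X_{1:n}=(X_1,\dots,X_n)$.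
   Formalization: Adds that Θ fills a fixed positive fraction of every small ball around each θ*_k; without this the claim fails, e.g. D=1, Θ=[0,1]∪{2}, P_0 uniform on [0,1] with p_0=1 on Θ, K=1, θ*_1=2, f standard normal. *)

theory Defs
  imports "HOL-Probability.Probability"
begin

subsection \<open>Derivatives as bounded linear maps\<close>

text \<open>
  Iterating \<open>grad\<close> gives the higher derivatives as (curried) multilinear maps, and \<open>norm\<close> is
  the operator norm on each level. All bounds on derivatives below hold up to an unspecified
  constant, so the choice of norm on the finite-dimensional space of \<open>g\<close>-linear forms is immaterial.
\<close>

definition grad :: "('a::real_normed_vector \<Rightarrow> 'b::real_normed_vector) \<Rightarrow> 'a \<Rightarrow> 'a \<Rightarrow>\<^sub>L 'b" where
  "grad f x = Blinfun (frechet_derivative f (at x))"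

definition C3 :: "('a::real_normed_vector \<Rightarrow> 'b::real_normed_vector) \<Rightarrow> bool" where
  "C3 f \<longleftrightarrow> f differentiable_on UNIV \<and> grad f differentiable_on UNIV
     \<and> grad (grad f) differentiable_on UNIV \<and> continuous_on UNIV (grad (grad (grad f)))"

lemma has_derivative_grad:
  assumes "f differentiable (at x)"
  shows "(f has_derivative blinfun_apply (grad f x)) (at x)"
proof -
  have d: "(f has_derivative frechet_derivative f (at x)) (at x)"
    using assms by (simp add: frechet_derivative_works)
  then have "blinfun_apply (grad f x) = frechet_derivative f (at x)"
    unfolding grad_def by (intro bounded_linear_Blinfun_apply has_derivative_bounded_linear)
  with d show ?thesis by simp
qed

subsection \<open>Mixtures\<close>

text \<open>The measure \<open>\<Sum>i\<in>I. w i \<cdot> \<delta>(\<theta> i)\<close> for nonnegative weights (see the lemmas below).\<close>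

definition discrete_measure ::
    "'i set \<Rightarrow> ('i \<Rightarrow> real) \<Rightarrow> ('i \<Rightarrow> 'a::topological_space) \<Rightarrow> 'a measure" where
  "discrete_measure I w \<theta> = distr (density (count_space I) (\<lambda>i. ennreal (w i))) borel \<theta>"

lemma sets_discrete_measure [simp, measurable_cong]: "sets (discrete_measure I w \<theta>) = sets borel"
  and space_discrete_measure [simp]: "space (discrete_measure I w \<theta>) = UNIV"
  by (simp_all add: discrete_measure_def)

lemma emeasure_discrete_measure:
  assumes "A \<in> sets borel"
  shows "emeasure (discrete_measure I w \<theta>) A
    = (\<integral>\<^sup>+i. ennreal (w i) * indicator A (\<theta> i) \<partial>count_space I)"
proof -
  have "emeasure (discrete_measure I w \<theta>) A
      = emeasure (density (count_space I) (\<lambda>i. ennreal (w i))) (\<theta> -` A \<inter> I)"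
    unfolding discrete_measure_def using assms by (subst emeasure_distr) simp_all
  also have "\<dots> = (\<integral>\<^sup>+i. ennreal (w i) * indicator (\<theta> -` A \<inter> I) i \<partial>count_space I)"
    by (subst emeasure_density) simp_all
  also have "\<dots> = (\<integral>\<^sup>+i. ennreal (w i) * indicator A (\<theta> i) \<partial>count_space I)"
    by (intro nn_integral_cong) (simp add: indicator_def)
  finally show ?thesis .
qed

lemma emeasure_discrete_measure_finite:
  assumes "finite I" "A \<in> sets borel"
  shows "emeasure (discrete_measure I w \<theta>) A = (\<Sum>i\<in>I. ennreal (w i) * indicator A (\<theta> i))"
  using assms by (simp add: emeasure_discrete_measure nn_integral_count_space_finite)

lemma emeasure_discrete_measure_nat:
  fixes w :: "nat \<Rightarrow> real"
  assumes "A \<in> sets borel"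
  shows "emeasure (discrete_measure UNIV w \<theta>) A = (\<Sum>k. ennreal (w k) * indicator A (\<theta> k))"
  using assms by (simp add: emeasure_discrete_measure nn_integral_count_space_nat)

definition mixture_density :: "('a::euclidean_space \<Rightarrow> real) \<Rightarrow> 'a measure \<Rightarrow> 'a \<Rightarrow> real" where
  "mixture_density f P x = (\<integral>\<theta>. f (x - \<theta>) \<partial>P)"

subsection \<open>The Dirichlet process\<close>

definition beta_measure :: "real \<Rightarrow> real \<Rightarrow> real measure" where
  "beta_measure a b = density lborel
     (\<lambda>x. ennreal (x powr (a - 1) * (1 - x) powr (b - 1) / Beta a b * indicator {0<..<1} x))"

lemma sets_beta_measure [simp, measurable_cong]: "sets (beta_measure a b) = sets borel"
  and space_beta_measure [simp]: "space (beta_measure a b) = UNIV"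
  by (simp_all add: beta_measure_def)

lemma prob_space_beta_measure:
  assumes "a > 0" "b > 0"
  shows "prob_space (beta_measure a b)"
proof
  let ?g = "\<lambda>x::real. x powr (a - 1) * (1 - x) powr (b - 1)"
  have B: "Beta a b > 0"
    using assms by (simp add: Beta_def Gamma_real_pos)
  have "((\<lambda>x. ?g x / Beta a b) has_integral (Beta a b / Beta a b)) {0<..<1}"
    using has_integral_divide[OF has_integral_Beta_real[OF assms], of "Beta a b"]
    by (simp add: has_integral_Icc_iff_Ioo)
  then have "((\<lambda>x. ?g x / Beta a b * indicator {0<..<1} x) has_integral 1) UNIV"
    using B by (subst (asm) has_integral_restrict_UNIV[symmetric])
      (simp add: indicator_def of_bool_def if_distrib cong: if_cong)
  then have "(\<integral>\<^sup>+x. ennreal (?g x / Beta a b * indicator {0<..<1} x) \<partial>lborel) = ennreal 1"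
    using B by (intro nn_integral_has_integral_lborel) (auto simp: indicator_def)
  then show "emeasure (beta_measure a b) (space (beta_measure a b)) = 1"
    unfolding beta_measure_def by (simp add: emeasure_density)
qed

definition stick_weight :: "(nat \<Rightarrow> real) \<Rightarrow> nat \<Rightarrow> real" where
  "stick_weight v k = v k * (\<Prod>j<k. 1 - v j)"

text \<open>
  On a null set of sequences \<open>v\<close> (for i.i.d. \<open>Beta(1,\<alpha>)\<close> sticks) the weights are not a
  probability vector; there the value is an arbitrary fixed probability measure, so that the map
  takes values in \<open>prob_algebra borel\<close> everywhere.
\<close>

definition stick_breaking :: "(nat \<Rightarrow> real) \<Rightarrow> (nat \<Rightarrow> 'a::euclidean_space) \<Rightarrow> 'a measure" where
  "stick_breaking v \<theta> =
    (let P = discrete_measure UNIV (stick_weight v) \<theta>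
     in if prob_space P then P else return borel 0)"

definition dirichlet_process :: "real \<Rightarrow> 'a::euclidean_space measure \<Rightarrow> 'a measure measure" where
  "dirichlet_process \<alpha> P0 =
    distr (PiM UNIV (\<lambda>_::nat. beta_measure 1 \<alpha>) \<Otimes>\<^sub>M PiM UNIV (\<lambda>_::nat. P0))
          (prob_algebra borel) (\<lambda>(v, \<theta>). stick_breaking v \<theta>)"

text \<open>\<open>distr\<close> is the image measure only for measurable maps.\<close>

lemma measurable_stick_breaking:
  fixes P0 :: "'a::euclidean_space measure"
  assumes [measurable_cong]: "sets P0 = sets borel"
  shows "(\<lambda>(v, \<theta>). stick_breaking v \<theta>)
    \<in> PiM UNIV (\<lambda>_::nat. beta_measure 1 \<alpha>) \<Otimes>\<^sub>M PiM UNIV (\<lambda>_::nat. P0) \<rightarrow>\<^sub>M prob_algebra borel"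
    (is "_ \<in> ?M \<rightarrow>\<^sub>M _")
proof (rule measurable_prob_algebraI)
  fix x :: "(nat \<Rightarrow> real) \<times> (nat \<Rightarrow> 'a)"
  show "prob_space (case x of (v, \<theta>) \<Rightarrow> stick_breaking v \<theta>)"
    by (auto simp: stick_breaking_def Let_def split: prod.split intro!: prob_space_return)
next
  have sw [measurable]: "(\<lambda>x. stick_weight (fst x) k) \<in> borel_measurable ?M" for k
    unfolding stick_weight_def by measurable
  have em [measurable]:
    "(\<lambda>x. emeasure (discrete_measure UNIV (stick_weight (fst x)) (snd x)) A) \<in> borel_measurable ?M"
    if [measurable]: "A \<in> sets borel" for A :: "'a set"
    using that by (simp add: emeasure_discrete_measure_nat) measurable
  have prob_iff: "prob_space (discrete_measure UNIV w \<theta>)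
      \<longleftrightarrow> emeasure (discrete_measure UNIV w \<theta>) UNIV = 1" for w :: "nat \<Rightarrow> real" and \<theta> :: "nat \<Rightarrow> 'a"
    using prob_space.emeasure_space_1 by (auto intro!: prob_spaceI) fastforce
  show "(\<lambda>(v, \<theta>). stick_breaking v \<theta>) \<in> ?M \<rightarrow>\<^sub>M subprob_algebra borel"
  proof (rule measurable_subprob_algebra)
    fix x :: "(nat \<Rightarrow> real) \<times> (nat \<Rightarrow> 'a)"
    show "subprob_space (case x of (v, \<theta>) \<Rightarrow> stick_breaking v \<theta>)"
      by (auto simp: stick_breaking_def Let_def split: prod.split
          intro!: prob_space_return prob_space_imp_subprob_space)
    show "sets (case x of (v, \<theta>) \<Rightarrow> stick_breaking v \<theta>) = sets borel"
      by (auto simp: stick_breaking_def Let_def split: prod.split)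
  next
    fix A :: "'a set" assume A [measurable]: "A \<in> sets borel"
    have "(\<lambda>x. if emeasure (discrete_measure UNIV (stick_weight (fst x)) (snd x)) UNIV = 1
        then emeasure (discrete_measure UNIV (stick_weight (fst x)) (snd x)) A
        else emeasure (return borel 0) A) \<in> borel_measurable ?M"
      by measurable
    moreover have "(\<lambda>x. emeasure (case x of (v, \<theta>) \<Rightarrow> stick_breaking v \<theta>) A)
      = (\<lambda>x. if emeasure (discrete_measure UNIV (stick_weight (fst x)) (snd x)) UNIV = 1
          then emeasure (discrete_measure UNIV (stick_weight (fst x)) (snd x)) A
          else emeasure (return borel 0) A)"
      by (auto simp: fun_eq_iff stick_breaking_def Let_def prob_iff)
    ultimately show "(\<lambda>x. emeasure (case x of (v, \<theta>) \<Rightarrow> stick_breaking v \<theta>) A) \<in> borel_measurable ?M"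
      by simp
  qed
qed

lemma prob_space_dirichlet_process:
  fixes P0 :: "'a::euclidean_space measure"
  assumes "\<alpha> > 0" "prob_space P0" "sets P0 = sets borel"
  shows "prob_space (dirichlet_process \<alpha> P0)"
proof -
  interpret B: prob_space "beta_measure 1 \<alpha>"
    using assms by (intro prob_space_beta_measure) auto
  interpret P0: prob_space P0 by fact
  interpret PB: product_prob_space "\<lambda>_::nat. beta_measure 1 \<alpha>" UNIV by unfold_locales
  interpret PP: product_prob_space "\<lambda>_::nat. P0" UNIV by unfold_locales
  interpret BP: pair_prob_space "PiM UNIV (\<lambda>_::nat. beta_measure 1 \<alpha>)" "PiM UNIV (\<lambda>_::nat. P0)"
    by unfold_locales
  show ?thesis
    unfolding dirichlet_process_def
    using assms by (intro BP.prob_space_distr measurable_stick_breaking) auto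
qed

subsection \<open>Lower density of a set at a point\<close>

text \<open>
  \<open>\<Theta>\<close> occupies a nonvanishing fraction of all small balls around \<open>x\<close>, so that a continuous
  density on \<open>\<Theta>\<close> that is positive at \<open>x\<close> gives mass of order at least \<open>r ^ D\<close> to the ball of
  radius \<open>r\<close> around \<open>x\<close>. This holds at interior points of \<open>\<Theta>\<close> and at all points of a convex body,
  but fails at isolated points and at cusps.
\<close>

definition fat_at :: "'a::euclidean_space set \<Rightarrow> 'a \<Rightarrow> bool" where
  "fat_at \<Theta> x \<longleftrightarrow>
    (\<exists>\<kappa>>0. \<forall>r. 0 < r \<and> r \<le> 1 \<longrightarrow> measure lborel (\<Theta> \<inter> ball x r) \<ge> \<kappa> * measure lborel (ball x r))"

lemma fat_at_interior:
  assumes "x \<in> interior \<Theta>" "\<Theta> \<in> sets borel"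
  shows "fat_at \<Theta> x"
proof -
  obtain e where e: "e > 0" "ball x e \<subseteq> \<Theta>"
    using assms(1) mem_interior by blast
  define \<delta> where "\<delta> = min e 1"
  have \<delta>: "0 < \<delta>" "\<delta> \<le> 1" "ball x \<delta> \<subseteq> \<Theta>"
    using e subset_ball[of \<delta> e x] by (auto simp: \<delta>_def)
  have "measure lborel (\<Theta> \<inter> ball x r) \<ge> \<delta> ^ DIM('a) * measure lborel (ball x r)"
    if r: "0 < r" "r \<le> 1" for r
  proof -
    have "\<delta> * r \<le> \<delta>" "\<delta> * r \<le> r"
      using \<delta> r mult_left_le[of r \<delta>] mult_right_le_one_le[of r \<delta>] by (simp_all add: mult.commute)
    then have "ball x (\<delta> * r) \<subseteq> \<Theta> \<inter> ball x r"
      using \<delta>(3) subset_ball[of "\<delta> * r" \<delta> x] subset_ball[of "\<delta> * r" r x] by blast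
    moreover have "\<Theta> \<inter> ball x r \<in> fmeasurable lborel"
      using assms(2) fmeasurable_Int_fmeasurable[of "ball x r" lborel \<Theta>] emeasure_lborel_ball_finite[of x r]
      by (simp add: fmeasurable_def Int_commute)
    ultimately have "measure lborel (ball x (\<delta> * r)) \<le> measure lborel (\<Theta> \<inter> ball x r)"
      by (intro measure_mono_fmeasurable) auto
    then show ?thesis
      using \<delta> r by (simp add: content_ball power_mult_distrib mult_ac)
  qed
  then show ?thesis
    unfolding fat_at_def using \<delta>(1) by (intro exI[of _ "\<delta> ^ DIM('a)"]) auto
qed

end

theory Submission
  imports Defs
begin

text \<open>
  Let \<open>r = 1 / sqrt n\<close> and let \<open>h\<close> be the ratio of the mixture density of \<open>P\<close> to the true density. The integral
  of the likelihood ratio over the prior is at least its integral over any neighbourhood \<open>A\<close> of the true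
  mixing measure, and two facts about a neighbourhood of radius \<open>r\<close> give the claim.
  
  First, its prior mass has the order of the claimed bound (\<open>prior_mass_near_mixing_measure\<close>). A
  stick-breaking measure is near the true one as soon as its first \<open>K\<close> atoms are within \<open>r\<close> of the true
  atoms, its first \<open>K - 1\<close> sticks within \<open>r\<close> of the true ones, and stick number \<open>K\<close> within \<open>r\<close> of \<open>1\<close>, so that at
  most \<open>r\<close> of the mass is left for all other atoms, wherever they are. These events are independent, with
  masses of order \<open>r powr D\<close> for each atom in dimension \<open>D\<close>, \<open>r\<close> for each of the \<open>K - 1\<close> sticks and \<open>r powr \<alpha>\<close>
  for the last one; with \<open>r = 1 / sqrt n\<close> the product has the order \<open>n powr (- (D * K + K - 1 + \<alpha>) / 2)\<close>.
  
  Second, on this neighbourhood the log-likelihood ratio costs only a constant factor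
  (\<open>evidence_lower_bound\<close>). The growth bound on the gradient of \<open>ln f\<close> gives an envelope \<open>G\<close> with
  \<open>\<bar>h - 1\<bar> \<le> G * r\<close> and \<open>h \<ge> 1 / G\<close> on \<open>A\<close> (\<open>mixture_sum_ratio\<close>), whose third moment is finite by the exponential
  moments of \<open>f\<close> (\<open>integrable_exp_envelope_shift\<close>). Hence \<open>ln h \<ge> (h - 1) - G ^ 3 / n\<close>. Averaged over \<open>A\<close> and
  summed over the sample, the linear part is a sum of \<open>n\<close> independent centred variables of size \<open>G / sqrt n\<close>,
  because \<open>h\<close> integrates to \<open>1\<close> against the true distribution; the other part is an average of \<open>G ^ 3\<close>. Both
  are bounded in probability, uniformly in \<open>n\<close>.
\<close>

section \<open>A lower bound for integrated likelihood ratios\<close>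

text \<open>
  After expanding the square, an off-diagonal term \<open>g (X i) * g (X j)\<close> is a product over independent
  coordinates and integrates to \<open>0\<close>; only the \<open>n\<close> diagonal terms survive.
\<close>

lemma iid_sum_second_moment:
  fixes g :: "'b \<Rightarrow> real"
  assumes Q: "prob_space Q" and g: "integrable Q g" "integrable Q (\<lambda>x. (g x)\<^sup>2)" "(\<integral>x. g x \<partial>Q) = 0"
  shows "integrable (PiM {..<n} (\<lambda>_. Q)) (\<lambda>X. (\<Sum>i<n. g (X i))\<^sup>2)"
    and "(\<integral>X. (\<Sum>i<n. g (X i))\<^sup>2 \<partial>PiM {..<n} (\<lambda>_. Q)) = real n * (\<integral>x. (g x)\<^sup>2 \<partial>Q)"
proof -
  interpret Q: prob_space Q by fact
  interpret product_prob_space "\<lambda>_::nat. Q" "{..<n}" by unfold_locales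
  have sq: "(\<Sum>i<n. g (X i))\<^sup>2 = (\<Sum>i<n. \<Sum>j<n. g (X i) * g (X j))" for X
    by (simp add: power2_eq_square sum_product)
  have ij: "integrable (PiM {..<n} (\<lambda>_. Q)) (\<lambda>X. g (X i) * g (X j)) \<and>
      (\<integral>X. g (X i) * g (X j) \<partial>PiM {..<n} (\<lambda>_. Q)) = (if i = j then \<integral>x. (g x)\<^sup>2 \<partial>Q else 0)"
    if ij: "i < n" "j < n" for i j
  proof -
    define F where "F k x = (if k = i then g x else 1) * (if k = j then g x else 1)" for k x
    have int: "integrable Q (F k)" for k
      using g by (cases "k = i"; cases "k = j") (simp_all add: F_def[abs_def] power2_eq_square)
    have eq: "(\<Prod>k<n. F k (X k)) = g (X i) * g (X j)" for X
      using ij by (simp add: F_def prod.distrib prod.delta')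
    have i1: "integrable (PiM {..<n} (\<lambda>_. Q)) (\<lambda>X. \<Prod>k<n. F k (X k))"
      by (rule product_integrable_prod) (auto simp: int)
    have i2: "(\<integral>X. (\<Prod>k<n. F k (X k)) \<partial>PiM {..<n} (\<lambda>_. Q)) = (\<Prod>k<n. \<integral>x. F k x \<partial>Q)"
      by (rule product_integral_prod) (auto simp: int)
    have "(\<Prod>k<n. \<integral>x. F k x \<partial>Q) = (if i = j then \<integral>x. (g x)\<^sup>2 \<partial>Q else 0)"
    proof (cases "i = j")
      case True
      have "(\<integral>x. F k x \<partial>Q) = (if k = i then \<integral>x. (g x)\<^sup>2 \<partial>Q else 1)" for k
        using True by (simp add: F_def power2_eq_square Q.prob_space)
      then show ?thesis using True ij by (simp add: prod.delta')
    next
      case False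
      have "(\<integral>x. F i x \<partial>Q) = 0"
        using False g by (simp add: F_def)
      then show ?thesis using False ij by (auto intro!: prod_zero)
    qed
    with i1 i2 show ?thesis by (simp add: eq)
  qed
  show "integrable (PiM {..<n} (\<lambda>_. Q)) (\<lambda>X. (\<Sum>i<n. g (X i))\<^sup>2)"
    unfolding sq using ij by (intro Bochner_Integration.integrable_sum) auto
  have "(\<integral>X. (\<Sum>i<n. g (X i))\<^sup>2 \<partial>PiM {..<n} (\<lambda>_. Q))
      = (\<Sum>i<n. \<Sum>j<n. if i = j then \<integral>x. (g x)\<^sup>2 \<partial>Q else 0)"
    unfolding sq using ij
    by (subst Bochner_Integration.integral_sum; (intro sum.cong refl Bochner_Integration.integrable_sum)?)
       (auto simp: Bochner_Integration.integral_sum)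
  then show "(\<integral>X. (\<Sum>i<n. g (X i))\<^sup>2 \<partial>PiM {..<n} (\<lambda>_. Q)) = real n * (\<integral>x. (g x)\<^sup>2 \<partial>Q)"
    by simp
qed

text \<open>
  This is \<open>ln (1 / h) \<le> 1 / h - 1\<close>, with \<open>1 - 1 / h\<close> split as \<open>(h - 1) - (h - 1)\<^sup>2 / h\<close>. The first-order
  term must stay exact: it is linear in the mixing measure and has mean zero under the true density.
  The remainder only has to be small, so it is bounded with the envelope \<open>G\<close>.
\<close>

lemma ln_ge_linear_minus_cube:
  fixes h G s :: real
  assumes G: "1 \<le> G" and h: "1 / G \<le> h" "\<bar>h - 1\<bar> \<le> G * s" "0 \<le> s"
  shows "ln h \<ge> (h - 1) - G ^ 3 * s\<^sup>2"
proof -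
  have h0: "h > 0" using G h(1) by (smt (verit) divide_pos_pos)
  have Gh: "1 / h \<le> G"
    using h(1) h0 G by (simp add: field_simps)
  have "(h - 1)\<^sup>2 \<le> (G * s)\<^sup>2"
    using h(2) by (metis abs_ge_zero power2_abs power_mono)
  then have "(h - 1)\<^sup>2 * (1 / h) \<le> (G * s)\<^sup>2 * G"
    using Gh h0 by (intro mult_mono) auto
  then have *: "(h - 1)\<^sup>2 / h \<le> G ^ 3 * s\<^sup>2"
    by (simp add: power2_eq_square power3_eq_cube mult_ac)
  have "ln (1 / h) \<le> 1 / h - 1"
    using h0 by (intro ln_le_minus_one) auto
  then have "ln h \<ge> 1 - 1 / h"
    using h0 by (simp add: ln_div)
  also have "1 - 1 / h = (h - 1) - (h - 1)\<^sup>2 / h"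
    using h0 by (simp add: field_simps power2_eq_square)
  finally show ?thesis using * by linarith
qed

text \<open>
  The tangent of \<open>exp\<close> at \<open>- t\<close> gives \<open>exp y \<ge> exp (- t) * (1 + t + y)\<close>. Applied to the log-likelihood
  ratio, this yields a bound that is affine in the single ratios \<open>h i\<close> and can therefore be averaged
  over a prior term by term; it does the work of Jensen's inequality.
\<close>

lemma prod_ge_exp_tangent:
  fixes h G :: "nat \<Rightarrow> real"
  assumes h: "\<And>i. i < n \<Longrightarrow> 1 \<le> G i \<and> 1 / G i \<le> h i \<and> \<bar>h i - 1\<bar> \<le> G i / sqrt n" and n: "n \<ge> 1"
  shows "(\<Prod>i<n. h i) \<ge> exp (- t) * (1 + t + (\<Sum>i<n. h i - 1) - (\<Sum>i<n. G i ^ 3) / n)"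
proof -
  have pos: "h i > 0" if "i < n" for i
    using h[OF that] by (smt (verit) divide_pos_pos)
  have "ln (h i) \<ge> (h i - 1) - G i ^ 3 * (1 / sqrt n)\<^sup>2" if "i < n" for i
    using h[OF that] by (intro ln_ge_linear_minus_cube) auto
  then have "(\<Sum>i<n. (h i - 1) - G i ^ 3 / n) \<le> (\<Sum>i<n. ln (h i))"
    using n by (intro sum_mono) (auto simp: power_divide)
  then have *: "(\<Sum>i<n. h i - 1) - (\<Sum>i<n. G i ^ 3) / n \<le> (\<Sum>i<n. ln (h i))"
    by (simp add: sum_subtractf sum_divide_distrib)
  have "(\<Prod>i<n. h i) = exp (\<Sum>i<n. ln (h i))"
    using pos by (simp add: exp_sum)
  also have "\<dots> = exp (- t) * exp (t + (\<Sum>i<n. ln (h i)))"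
    by (simp add: exp_minus exp_add)
  also have "\<dots> \<ge> exp (- t) * (1 + (t + (\<Sum>i<n. ln (h i))))"
    by (intro mult_left_mono exp_ge_add_one_self) auto
  finally show ?thesis
    using * by (smt (verit) exp_gt_zero mult_left_mono)
qed

text \<open>
  Averaging the bound of the previous lemma over \<open>A\<close> leaves \<open>1 + t\<close> plus two fluctuating terms:
  the sum of \<open>n\<close> independent copies of \<open>g\<close>, the average of \<open>h - 1\<close> over \<open>A\<close>, and the mean of the \<open>n\<close>
  values of \<open>G ^ 3\<close>. By Fubini \<open>g\<close> has mean zero, and it is at most \<open>G / sqrt n\<close>, so the second
  moment of the sum is bounded in \<open>n\<close>. Markov's inequality then bounds both terms by \<open>t\<close> up to a
  probability of order \<open>1 / t\<close>, uniformly in \<open>n\<close>.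
\<close>

lemma evidence_lower_bound:
  fixes h :: "'w \<Rightarrow> 'x \<Rightarrow> real" and G :: "'x \<Rightarrow> real" and n :: nat and a t :: real
  assumes M: "prob_space M" and Q: "prob_space Q"
    and h_meas: "(\<lambda>(w, x). h w x) \<in> borel_measurable (M \<Otimes>\<^sub>M Q)"
    and h_nonneg: "\<And>w x. w \<in> space M \<Longrightarrow> x \<in> space Q \<Longrightarrow> 0 \<le> h w x"
    and h_int: "\<And>X. X \<in> space (PiM {..<n} (\<lambda>_. Q)) \<Longrightarrow> integrable M (\<lambda>w. \<Prod>i<n. h w (X i))"
    and A: "A \<in> sets M" and a: "0 < a" "a \<le> measure M A"
    and G: "G \<in> borel_measurable Q" "\<And>x. x \<in> space Q \<Longrightarrow> 1 \<le> G x" "integrable Q (\<lambda>x. G x ^ 3)"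
    and h_near: "\<And>w x. w \<in> A \<Longrightarrow> x \<in> space Q \<Longrightarrow> \<bar>h w x - 1\<bar> \<le> G x / sqrt n"
    and h_low: "\<And>w x. w \<in> A \<Longrightarrow> x \<in> space Q \<Longrightarrow> 1 / G x \<le> h w x"
    and h_mean: "\<And>w. w \<in> A \<Longrightarrow> (\<integral>x. h w x \<partial>Q) = 1"
    and n: "n \<ge> 1" and t: "t > 0"
  shows "measure (PiM {..<n} (\<lambda>_. Q))
      {X \<in> space (PiM {..<n} (\<lambda>_. Q)). (\<integral>w. (\<Prod>i<n. h w (X i)) \<partial>M) \<ge> exp (- t) * a}
    \<ge> 1 - (1 + 2 * (\<integral>x. G x ^ 3 \<partial>Q)) / t"
proof -
  interpret M: prob_space M by fact
  interpret Q: prob_space Q by fact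
  interpret MQ: pair_prob_space M Q by unfold_locales
  interpret PQ: product_prob_space "\<lambda>_::nat. Q" "{..<n}" by unfold_locales
  let ?PQ = "PiM {..<n} (\<lambda>_. Q)"
  have A: "A \<in> sets M" "measure M A > 0" using A a by auto
  note [measurable] = h_meas A(1) G(1)
  have G_le: "G x \<le> G x ^ 3" "(G x)\<^sup>2 \<le> G x ^ 3" if "x \<in> space Q" for x
    using G(2)[OF that] power_increasing[of 1 3 "G x"] power_increasing[of 2 3 "G x"] by auto
  have G_abs: "\<bar>G x\<bar> = G x" if "x \<in> space Q" for x
    using G(2)[OF that] by simp
  have G_int: "integrable Q G"
    by (rule Bochner_Integration.integrable_bound[OF G(3)])
       (auto intro!: AE_I2 simp: power_abs G_abs G_le)
  have G2_int: "integrable Q (\<lambda>x. (G x)\<^sup>2)"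
    by (rule Bochner_Integration.integrable_bound[OF G(3)])
       (auto intro!: AE_I2 simp: power_abs G_abs G_le)
  \<comment> \<open>The cut-off to \<open>A\<close> is built into \<open>d\<close>, so that all its bounds hold for every \<open>w\<close>.\<close>
  define d where "d w x = indicator A w * (h w x - 1)" for w x
  have d_meas[measurable]: "(\<lambda>(w, x). d w x) \<in> borel_measurable (M \<Otimes>\<^sub>M Q)"
    unfolding d_def by measurable
  have sn: "sqrt n \<ge> 1" using n by simp
  have d_le: "\<bar>d w x\<bar> \<le> G x / sqrt n" if "x \<in> space Q" for w x
    using h_near[OF _ that, of w] G(2)[OF that] by (auto simp: d_def indicator_def)
  have d_leG: "\<bar>d w x\<bar> \<le> G x" if "x \<in> space Q" for w x
  proof -
    have "G x / sqrt n \<le> G x / 1" using sn G(2)[OF that] by (intro divide_left_mono) auto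
    then show ?thesis using d_le[OF that, of w] by simp
  qed
  have d_int: "integrable M (\<lambda>w. d w x)" if [measurable]: "x \<in> space Q" for x
    by (rule M.integrable_const_bound[where B="G x"]) (use d_leG[OF that] in auto)
  have ind_int: "integrable M (indicator A :: _ \<Rightarrow> real)"
    using A by (simp add: M.emeasure_eq_measure)
  define g where "g x = (\<integral>w. d w x \<partial>M) / measure M A" for x
  have g_meas[measurable]: "g \<in> borel_measurable Q"
    unfolding g_def by measurable
  have g_le: "\<bar>g x\<bar> \<le> G x / sqrt n" if x: "x \<in> space Q" for x
  proof -
    have "\<bar>\<integral>w. d w x \<partial>M\<bar> \<le> (\<integral>w. \<bar>d w x\<bar> \<partial>M)"
      using integral_norm_bound[of M "\<lambda>w. d w x"] by simp
    also have "\<dots> \<le> (\<integral>w. indicator A w * (G x / sqrt n) \<partial>M)"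
    proof (intro integral_mono integrable_abs d_int x integrable_mult_left ind_int)
      show "\<bar>d w x\<bar> \<le> indicator A w * (G x / sqrt n)" for w
        using h_near[OF _ x] by (auto simp: d_def indicator_def)
    qed
    also have "\<dots> = measure M A * (G x / sqrt n)"
      using A by simp
    finally show ?thesis
      using A(2) by (simp add: g_def field_simps)
  qed
  have g_int: "integrable Q g"
    by (rule Bochner_Integration.integrable_bound[OF integrable_divide[OF G_int, of "sqrt n"]])
       (auto intro!: AE_I2 simp: G_abs g_le)
  have g2_le: "(g x)\<^sup>2 \<le> (G x)\<^sup>2 / n" if x: "x \<in> space Q" for x
  proof -
    have "(g x)\<^sup>2 \<le> (G x / sqrt n)\<^sup>2"
      using g_le[OF x] by (metis abs_ge_zero power2_abs power_mono)
    then show ?thesis by (simp add: power_divide)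
  qed
  have g2_int: "integrable Q (\<lambda>x. (g x)\<^sup>2)"
    by (rule Bochner_Integration.integrable_bound[OF integrable_divide[OF G2_int, of "real n"]])
       (use g2_le in \<open>auto intro!: AE_I2\<close>)
  have g_mean: "(\<integral>x. g x \<partial>Q) = 0"
  proof -
    have dI: "integrable (M \<Otimes>\<^sub>M Q) (\<lambda>(w, x). d w x)"
    proof (rule Bochner_Integration.integrable_bound)
      show "integrable (M \<Otimes>\<^sub>M Q) (\<lambda>(w, x). G x)"
        using G_int by (intro MQ.Fubini_integrable) auto
      show "AE p in M \<Otimes>\<^sub>M Q. norm (case p of (w, x) \<Rightarrow> d w x) \<le> norm (case p of (w, x) \<Rightarrow> G x)"
      proof (rule AE_I2)
        fix p assume "p \<in> space (M \<Otimes>\<^sub>M Q)"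
        then show "norm (case p of (w, x) \<Rightarrow> d w x) \<le> norm (case p of (w, x) \<Rightarrow> G x)"
          using d_leG[of "snd p" "fst p"] G_abs[of "snd p"] by (auto simp: space_pair_measure split: prod.split)
      qed
    qed simp
    have zero: "(\<integral>x. d w x \<partial>Q) = 0" if "w \<in> space M" for w
    proof (cases "w \<in> A")
      case True
      have [measurable]: "h w \<in> borel_measurable Q" using that by measurable
      have "integrable Q (h w)"
        using h_mean[OF True] not_integrable_integral_eq by fastforce
      then show ?thesis using True h_mean[OF True]
        by (simp add: d_def Q.prob_space)
    qed (simp add: d_def)
    have "(\<integral>x. (\<integral>w. d w x \<partial>M) \<partial>Q) = (\<integral>w. (\<integral>x. d w x \<partial>Q) \<partial>M)"
      using MQ.Fubini_integral[OF dI] by simp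
    also have "\<dots> = (\<integral>w. 0 \<partial>M)"
      by (intro Bochner_Integration.integral_cong zero) auto
    finally show ?thesis by (simp add: g_def)
  qed
  \<comment> \<open>A single variable controls both fluctuations, because \<open>- s \<le> 1 + s\<^sup>2\<close>: the square handles the
    centred sum and needs only second moments.\<close>
  define W where "W X = 1 + (\<Sum>i<n. g (X i))\<^sup>2 + (\<Sum>i<n. G (X i) ^ 3) / n" for X
  have comp: "integrable ?PQ (\<lambda>X. G (X i) ^ 3)" "(\<integral>X. G (X i) ^ 3 \<partial>?PQ) = (\<integral>x. G x ^ 3 \<partial>Q)"
    if "i < n" for i
  proof -
    have D: "distr ?PQ Q (\<lambda>X. X i) = Q" using PQ.PiM_component[of i] that by simp
    have m: "(\<lambda>X. X i) \<in> ?PQ \<rightarrow>\<^sub>M Q" using that by (intro measurable_component_singleton) auto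
    show "integrable ?PQ (\<lambda>X. G (X i) ^ 3)"
      using integrable_distr[OF m, of "\<lambda>x. G x ^ 3"] G(3) D by simp
    show "(\<integral>X. G (X i) ^ 3 \<partial>?PQ) = (\<integral>x. G x ^ 3 \<partial>Q)"
      using integral_distr[OF m, of "\<lambda>x. G x ^ 3"] D by simp
  qed
  note sm = iid_sum_second_moment[OF Q g_int g2_int g_mean, of n]
  have W_int: "integrable ?PQ W"
    unfolding W_def using sm comp by (intro Bochner_Integration.integrable_add integrable_divide Bochner_Integration.integrable_sum) auto
  have "(\<integral>X. W X \<partial>?PQ) = 1 + real n * (\<integral>x. (g x)\<^sup>2 \<partial>Q) + (\<integral>x. G x ^ 3 \<partial>Q)"
  proof -
    have s: "integrable ?PQ (\<lambda>X. (\<Sum>i<n. G (X i) ^ 3) / n)"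
      by (intro integrable_divide Bochner_Integration.integrable_sum comp) auto
    have "(\<integral>X. (\<Sum>i<n. G (X i) ^ 3) / n \<partial>?PQ) = (\<integral>x. G x ^ 3 \<partial>Q)"
      using comp n by (simp add: Bochner_Integration.integral_sum)
    then show ?thesis
      unfolding W_def using sm s by (simp add: PQ.P.prob_space)
  qed
  also have "real n * (\<integral>x. (g x)\<^sup>2 \<partial>Q) \<le> real n * (\<integral>x. G x ^ 3 / n \<partial>Q)"
  proof (intro mult_left_mono integral_mono g2_int integrable_divide G(3))
    fix x assume x: "x \<in> space Q"
    show "(g x)\<^sup>2 \<le> G x ^ 3 / n"
      using g2_le[OF x] G_le(2)[OF x] n by (meson divide_right_mono of_nat_0_le_iff order.trans)
  qed simp
  also have "real n * (\<integral>x. G x ^ 3 / n \<partial>Q) = (\<integral>x. G x ^ 3 \<partial>Q)"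
    using n by simp
  finally have EW: "(\<integral>X. W X \<partial>?PQ) \<le> 1 + 2 * (\<integral>x. G x ^ 3 \<partial>Q)" by simp
  have W_nonneg: "0 \<le> W X" if "X \<in> space ?PQ" for X
  proof -
    have "G (X i) \<ge> 1" if "i < n" for i
      using that \<open>X \<in> space ?PQ\<close> G(2) by (auto simp: space_PiM PiE_iff)
    then have "0 \<le> (\<Sum>i<n. G (X i) ^ 3)" by (intro sum_nonneg zero_le_power) (force dest: le_less_trans)
    then show ?thesis by (simp add: W_def)
  qed
  have W_meas[measurable]: "W \<in> borel_measurable ?PQ" using W_int by simp
  have "measure ?PQ {X \<in> space ?PQ. W X \<ge> t} \<le> (\<integral>X. W X \<partial>?PQ) / t"
    using integral_Markov_inequality_measure[OF W_int, of "{}" t] W_nonneg t by auto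
  also have "\<dots> \<le> (1 + 2 * (\<integral>x. G x ^ 3 \<partial>Q)) / t"
    using EW t by (intro divide_right_mono) auto
  finally have bad: "measure ?PQ {X \<in> space ?PQ. W X \<ge> t} \<le> (1 + 2 * (\<integral>x. G x ^ 3 \<partial>Q)) / t" .
  have key: "(\<integral>w. (\<Prod>i<n. h w (X i)) \<partial>M) \<ge> exp (- t) * a"
    if X: "X \<in> space ?PQ" and W: "W X < t" for X
  proof -
    have Xi: "X i \<in> space Q" if "i < n" for i using X that by (auto simp: space_PiM PiE_iff)
    define c where "c = 1 + t - (\<Sum>i<n. G (X i) ^ 3) / n"
    have c1: "1 \<le> c + (\<Sum>i<n. g (X i))"
    proof -
      have "- s \<le> 1 + s\<^sup>2" for s :: real
        using sum_squares_ge_zero[of "s + 1/2" 0] by (simp add: power2_eq_square algebra_simps)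
      from this[of "\<Sum>i<n. g (X i)"] show ?thesis using W by (simp add: W_def c_def)
    qed
    have rhs_int: "integrable M (\<lambda>w. exp (- t) * (c * indicator A w + (\<Sum>i<n. d w (X i))))"
      using A by (intro integrable_mult_right Bochner_Integration.integrable_add
        Bochner_Integration.integrable_sum d_int Xi) (auto simp: M.emeasure_eq_measure)
    have "measure M A \<le> measure M A * (c + (\<Sum>i<n. g (X i)))"
      using c1 by (simp add: mult_le_cancel_left1)
    then have "exp (- t) * a \<le> exp (- t) * (measure M A * (c + (\<Sum>i<n. g (X i))))"
      using a(2) by (intro mult_left_mono) auto
    also have "measure M A * (c + (\<Sum>i<n. g (X i))) = c * measure M A + (\<Sum>i<n. \<integral>w. d w (X i) \<partial>M)"
      using A(2) by (simp add: g_def algebra_simps flip: sum_divide_distrib)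
    also have "exp (- t) * \<dots> = (\<integral>w. exp (- t) * (c * indicator A w + (\<Sum>i<n. d w (X i))) \<partial>M)"
    proof -
      have "integrable M (\<lambda>w. \<Sum>i<n. d w (X i))"
        by (intro Bochner_Integration.integrable_sum d_int Xi) simp
      then show ?thesis
        using A Xi ind_int by (simp add: Bochner_Integration.integral_sum d_int)
    qed
    also have "\<dots> \<le> (\<integral>w. (\<Prod>i<n. h w (X i)) \<partial>M)"
    proof (rule integral_mono[OF rhs_int h_int[OF X]])
      fix w assume w: "w \<in> space M"
      show "exp (- t) * (c * indicator A w + (\<Sum>i<n. d w (X i))) \<le> (\<Prod>i<n. h w (X i))"
      proof (cases "w \<in> A")
        case True
        have "exp (- t) * (1 + t + (\<Sum>i<n. h w (X i) - 1) - (\<Sum>i<n. G (X i) ^ 3) / n) \<le> (\<Prod>i<n. h w (X i))"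
          using h_near[OF True Xi] h_low[OF True Xi] G(2)[OF Xi] n by (intro prod_ge_exp_tangent) auto
        then show ?thesis using True by (simp add: c_def d_def algebra_simps)
      next
        case False
        then show ?thesis using h_nonneg[OF w Xi] by (auto simp: d_def intro!: prod_nonneg)
      qed
    qed
    finally show ?thesis .
  qed
  have ev_meas: "{X \<in> space ?PQ. (\<integral>w. (\<Prod>i<n. h w (X i)) \<partial>M) \<ge> exp (- t) * a} \<in> sets ?PQ"
    by measurable
  have "1 - (1 + 2 * (\<integral>x. G x ^ 3 \<partial>Q)) / t \<le> 1 - measure ?PQ {X \<in> space ?PQ. W X \<ge> t}"
    using bad by simp
  also have "\<dots> = measure ?PQ (space ?PQ - {X \<in> space ?PQ. W X \<ge> t})"
    by (subst PQ.prob_compl) auto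
  also have "\<dots> \<le> measure ?PQ {X \<in> space ?PQ. (\<integral>w. (\<Prod>i<n. h w (X i)) \<partial>M) \<ge> exp (- t) * a}"
    using key by (intro PQ.finite_measure_mono ev_meas) (auto simp: not_le)
  finally show ?thesis .
qed

section \<open>Likelihood ratios of neighbouring mixtures\<close>

text \<open>
  The segment between \<open>x - a\<close> and \<open>x - b\<close> stays in the ball of radius \<open>norm x + L\<close>, where the gradient
  of \<open>ln f\<close> is at most the stated Lipschitz constant.
\<close>

lemma ln_shift_Lipschitz:
  fixes f :: "'a::euclidean_space \<Rightarrow> real"
  assumes diff: "\<And>x. f differentiable (at x)" and pos: "\<And>x. 0 < f x"
    and bound: "\<And>x. norm (grad (\<lambda>y. ln (f y)) x) \<le> R * (1 + norm x) powr \<gamma>"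
    and R: "0 \<le> R" "0 \<le> \<gamma>" and a: "norm a \<le> L" "norm b \<le> L"
  shows "\<bar>ln (f (x - a)) - ln (f (x - b))\<bar> \<le> R * (1 + L + norm x) powr \<gamma> * norm (a - b)"
proof -
  let ?g = "\<lambda>y. ln (f y)" and ?S = "cball (0::'a) (norm x + L)"
  have d: "?g differentiable (at y)" for y
  proof -
    obtain D where "(f has_derivative D) (at y)"
      using diff[of y] by (auto simp: differentiable_def)
    then have "(?g has_derivative (\<lambda>h. D h * inverse (f y))) (at y)"
      by (intro DERIV_compose_FDERIV[where f = ln and g = f] DERIV_ln pos)
    then show ?thesis
      by (auto simp: differentiable_def)
  qed
  have mem: "x - c \<in> ?S" if "norm c \<le> L" for c
    using that norm_triangle_ineq4[of x c] by (simp add: norm_minus_commute)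
  have "norm (?g (x - a) - ?g (x - b)) \<le> R * (1 + L + norm x) powr \<gamma> * norm ((x - a) - (x - b))"
  proof (rule differentiable_bound[of ?S])
    show "(?g has_derivative blinfun_apply (grad ?g y)) (at y within ?S)" for y
      by (rule has_derivative_at_withinI[OF has_derivative_grad[OF d]])
    show "onorm (blinfun_apply (grad ?g y)) \<le> R * (1 + L + norm x) powr \<gamma>" if "y \<in> ?S" for y
    proof -
      have "R * (1 + norm y) powr \<gamma> \<le> R * (1 + L + norm x) powr \<gamma>"
        using that R by (intro mult_left_mono powr_mono2) auto
      with bound[of y] show ?thesis by (simp add: norm_blinfun.rep_eq)
    qed
    show "x - a \<in> ?S" "x - b \<in> ?S" using mem a by blast+
  qed simp
  moreover have "norm ((x - a) - (x - b)) = norm (a - b)"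
    using norm_minus_commute[of a b] by simp
  ultimately show ?thesis by (simp only: real_norm_def)
qed

lemma abs_exp_diff_le:
  fixes p q c :: real
  assumes "0 < p" "0 < q" "\<bar>ln p - ln q\<bar> \<le> c"
  shows "\<bar>p - q\<bar> \<le> q * (c * exp c)" "p \<le> q * exp c"
proof -
  define u where "u = ln p - ln q"
  have p: "p = q * exp u" using assms by (simp add: u_def exp_diff)
  have u: "\<bar>u\<bar> \<le> c" using assms by (simp add: u_def)
  have "\<bar>exp u - 1\<bar> \<le> c * exp c"
  proof (cases "u \<ge> 0")
    case True
    have "1 - u \<le> exp (- u)" using exp_ge_add_one_self[of "-u"] by simp
    then have "exp u * (1 - u) \<le> exp u * exp (- u)" by (intro mult_left_mono) auto
    then have "exp u - 1 \<le> u * exp u" by (simp add: exp_minus algebra_simps)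
    also have "\<dots> \<le> c * exp c" using u True by (intro mult_mono) auto
    finally show ?thesis using True by simp
  next
    case False
    have "1 - exp u \<le> - u" using exp_ge_add_one_self[of u] by linarith
    also have "\<dots> \<le> c * 1" using u by simp
    also have "\<dots> \<le> c * exp c" using u by (intro mult_left_mono) auto
    finally show ?thesis using False by simp
  qed
  moreover have "p - q = q * (exp u - 1)" by (simp add: p algebra_simps)
  ultimately show "\<bar>p - q\<bar> \<le> q * (c * exp c)" using assms(2) by (simp add: abs_mult)
  show "p \<le> q * exp c" using u assms(2) by (simp add: p)
qed

text \<open>
  Here \<open>\<phi> a\<close> stands for \<open>f (x - a)\<close> at a fixed point \<open>x\<close>. Since \<open>ln \<phi>\<close> is Lipschitz on a set of diameter
  \<open>d\<close>, any two values of \<open>\<phi>\<close> on it, and hence any value and any mixture of values, agree up to the factor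
  \<open>E = exp (b * d)\<close>. This gives the lower bound on \<open>p / ps\<close> and lets the tail be bounded by \<open>r\<close> times
  \<open>E * ps\<close>. In the first \<open>K\<close> terms, moving a weight costs \<open>C * r\<close> and moving an atom costs a relative
  error \<open>b * r * exp (b * r) \<le> r * exp (2 * b)\<close>.
\<close>

lemma mixture_sum_ratio:
  fixes \<phi> :: "'a::euclidean_space \<Rightarrow> real" and w ws :: "nat \<Rightarrow> real" and \<theta> \<theta>s :: "nat \<Rightarrow> 'a"
    and K :: nat and b d r C :: real
  assumes pos: "\<And>a. a \<in> \<Theta> \<Longrightarrow> 0 < \<phi> a"
    and lip: "\<And>a a'. a \<in> \<Theta> \<Longrightarrow> a' \<in> \<Theta> \<Longrightarrow> \<bar>ln (\<phi> a) - ln (\<phi> a')\<bar> \<le> b * norm (a - a')"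
    and diam: "\<And>a a'. a \<in> \<Theta> \<Longrightarrow> a' \<in> \<Theta> \<Longrightarrow> norm (a - a') \<le> d"
    and b: "0 \<le> b" and C: "0 \<le> C" and r: "0 < r" "r \<le> 1"
    and ws: "\<And>k. k < K \<Longrightarrow> 0 \<le> ws k" "(\<Sum>k<K. ws k) = 1" and \<theta>s: "\<And>k. k < K \<Longrightarrow> \<theta>s k \<in> \<Theta>"
    and w: "\<And>k. 0 \<le> w k" "w sums 1" and \<theta>: "\<And>k. \<theta> k \<in> \<Theta>"
    and near_w: "\<And>k. k < K \<Longrightarrow> \<bar>w k - ws k\<bar> \<le> C * r" and near_\<theta>: "\<And>k. k < K \<Longrightarrow> norm (\<theta> k - \<theta>s k) \<le> r"
    and tail: "1 - (\<Sum>k<K. w k) \<le> r"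
  defines "p \<equiv> \<Sum>k. w k * \<phi> (\<theta> k)" and "ps \<equiv> \<Sum>k<K. ws k * \<phi> (\<theta>s k)" and "G \<equiv> (K * C + 2) * exp (b * (d + 2))"
  shows "\<bar>p / ps - 1\<bar> \<le> G * r" "1 / G \<le> p / ps"
proof -
  define E where "E = exp (b * d)"
  have d: "0 \<le> d" using diam[of "\<theta> 0" "\<theta> 0"] \<theta> by simp
  have E: "1 \<le> E" using b d by (simp add: E_def)
  have le: "\<phi> a \<le> \<phi> a' * E" if "a \<in> \<Theta>" "a' \<in> \<Theta>" for a a'
    unfolding E_def using that
    by (intro abs_exp_diff_le(2) pos order.trans[OF lip] mult_left_mono diam b) auto
  have ps_up: "\<phi> a \<le> ps * E" if "a \<in> \<Theta>" for a
  proof -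
    have "\<phi> a = (\<Sum>k<K. ws k * \<phi> a)" by (simp add: ws(2) flip: sum_distrib_right)
    also have "\<dots> \<le> (\<Sum>k<K. ws k * (\<phi> (\<theta>s k) * E))"
      using ws \<theta>s that by (intro sum_mono mult_left_mono le) auto
    also have "\<dots> = ps * E" by (simp add: ps_def sum_distrib_right mult.assoc)
    finally show ?thesis .
  qed
  have ps_low: "ps \<le> \<phi> a * E" if "a \<in> \<Theta>" for a
  proof -
    have "ps \<le> (\<Sum>k<K. ws k * (\<phi> a * E))"
      unfolding ps_def using ws \<theta>s that by (intro sum_mono mult_left_mono le) auto
    also have "\<dots> = \<phi> a * E" by (simp add: ws(2) flip: sum_distrib_right)
    finally show ?thesis .
  qed
  have ps0: "0 < ps"
  proof -
    have "0 < ps * E" using ps_up[OF \<theta>[of 0]] pos[OF \<theta>[of 0]] by linarith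
    then show ?thesis using E by (simp add: zero_less_mult_iff)
  qed
  have sw: "summable w" "suminf w = 1" using w(2) by (auto simp: sums_iff)
  have bnd: "0 \<le> w k * \<phi> (\<theta> k)" "w k * \<phi> (\<theta> k) \<le> w k * (ps * E)" "w k * (ps / E) \<le> w k * \<phi> (\<theta> k)" for k
  proof -
    have "ps / E \<le> \<phi> (\<theta> k)" using ps_low[OF \<theta>[of k]] E by (simp add: pos_divide_le_eq)
    then show "w k * (ps / E) \<le> w k * \<phi> (\<theta> k)" using w by (intro mult_left_mono) auto
    show "0 \<le> w k * \<phi> (\<theta> k)" using w pos[OF \<theta>] by (simp add: less_imp_le)
    show "w k * \<phi> (\<theta> k) \<le> w k * (ps * E)" using w ps_up[OF \<theta>] by (intro mult_left_mono) auto
  qed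
  have sp: "summable (\<lambda>k. w k * \<phi> (\<theta> k))"
  proof (rule summable_comparison_test'[OF summable_mult2[OF sw(1), of "ps * E"], of 0])
    show "norm (w k * \<phi> (\<theta> k)) \<le> w k * (ps * E)" for k
      unfolding real_norm_def abs_of_nonneg[OF bnd(1)] by (rule bnd(2))
  qed
  have "ps / E = (\<Sum>k. w k * (ps / E))" using suminf_mult2[OF sw(1), of "ps / E"] by (simp only: sw(2) mult_1)
  also have "\<dots> \<le> p" unfolding p_def by (intro suminf_le bnd sp summable_mult2 sw)
  finally have low: "ps / E \<le> p" .
  have split: "p = (\<Sum>k. w (k + K) * \<phi> (\<theta> (k + K))) + (\<Sum>k<K. w k * \<phi> (\<theta> k))"
    unfolding p_def using suminf_split_initial_segment[OF sp, of K] by simp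
  have shift: "summable (\<lambda>k. w (k + K) * \<phi> (\<theta> (k + K)))" "summable (\<lambda>k. w (k + K))"
    using summable_ignore_initial_segment[OF sp, of K] summable_ignore_initial_segment[OF sw(1), of K] by auto
  have tail_eq: "(\<Sum>k. w (k + K)) = 1 - (\<Sum>k<K. w k)"
    using suminf_split_initial_segment[OF sw(1), of K] sw(2) by simp
  have tail0: "0 \<le> (\<Sum>k. w (k + K) * \<phi> (\<theta> (k + K)))"
    by (intro suminf_nonneg shift bnd)
  have "(\<Sum>k. w (k + K) * \<phi> (\<theta> (k + K))) \<le> (\<Sum>k. w (k + K) * (ps * E))"
    by (intro suminf_le bnd summable_mult2 shift)
  also have "\<dots> = (1 - (\<Sum>k<K. w k)) * (ps * E)"
    using suminf_mult2[OF shift(2), of "ps * E"] by (simp only: tail_eq)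
  also have "\<dots> \<le> r * (ps * E)" using tail ps0 E by (intro mult_right_mono) auto
  finally have tail1: "(\<Sum>k. w (k + K) * \<phi> (\<theta> (k + K))) \<le> r * (ps * E)" .
  have near_term: "\<bar>w k * \<phi> (\<theta> k) - ws k * \<phi> (\<theta>s k)\<bar> \<le> C * r * (ps * E) + ws k * (r * (ps * E) * exp (2 * b))"
    if k: "k < K" for k
  proof -
    have "\<bar>ln (\<phi> (\<theta> k)) - ln (\<phi> (\<theta>s k))\<bar> \<le> b * r"
      by (rule order.trans[OF lip[OF \<theta> \<theta>s[OF k]] mult_left_mono[OF near_\<theta>[OF k] b]])
    then have "\<bar>\<phi> (\<theta> k) - \<phi> (\<theta>s k)\<bar> \<le> \<phi> (\<theta>s k) * (b * r * exp (b * r))"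
      by (intro abs_exp_diff_le(1) pos \<theta> \<theta>s k)
    also have "\<dots> \<le> (ps * E) * ((exp b * r) * exp b)"
    proof (intro mult_mono ps_up \<theta>s k)
      show "b \<le> exp b" using exp_ge_add_one_self[of b] by linarith
      show "exp (b * r) \<le> exp b" using b r by (simp add: mult_left_le)
    qed (use b r ps0 E in \<open>auto intro!: mult_nonneg_nonneg\<close>)
    finally have 1: "\<bar>\<phi> (\<theta> k) - \<phi> (\<theta>s k)\<bar> \<le> r * (ps * E) * exp (2 * b)"
      unfolding exp_double power2_eq_square by (simp only: mult_ac)
    have "w k * \<phi> (\<theta> k) - ws k * \<phi> (\<theta>s k) = (w k - ws k) * \<phi> (\<theta> k) + ws k * (\<phi> (\<theta> k) - \<phi> (\<theta>s k))"
      by (simp add: algebra_simps)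
    also have "\<bar>\<dots>\<bar> \<le> \<bar>w k - ws k\<bar> * \<phi> (\<theta> k) + ws k * \<bar>\<phi> (\<theta> k) - \<phi> (\<theta>s k)\<bar>"
      using pos[OF \<theta>[of k]] ws(1)[OF k] by (intro order.trans[OF abs_triangle_ineq]) (simp add: abs_mult)
    also have "\<dots> \<le> C * r * (ps * E) + ws k * (r * (ps * E) * exp (2 * b))"
      using near_w[OF k] ps_up[OF \<theta>[of k]] pos[OF \<theta>[of k]] ws(1)[OF k] 1 C r
      by (intro add_mono mult_mono mult_left_mono) auto
    finally show ?thesis .
  qed
  have "p - ps = (\<Sum>k. w (k + K) * \<phi> (\<theta> (k + K))) + (\<Sum>k<K. w k * \<phi> (\<theta> k) - ws k * \<phi> (\<theta>s k))"
    by (simp only: split ps_def sum_subtractf add_diff_eq)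
  then have "\<bar>p - ps\<bar> \<le> r * (ps * E) + \<bar>\<Sum>k<K. w k * \<phi> (\<theta> k) - ws k * \<phi> (\<theta>s k)\<bar>"
    using tail0 tail1 by linarith
  also have "\<dots> \<le> r * (ps * E) + (\<Sum>k<K. C * r * (ps * E) + ws k * (r * (ps * E) * exp (2 * b)))"
    by (intro add_left_mono order.trans[OF sum_abs] sum_mono near_term) auto
  also have "\<dots> = r * (ps * E) + (K * (C * r * (ps * E)) + r * (ps * E) * exp (2 * b))"
    by (simp add: sum.distrib ws(2) flip: sum_distrib_right)
  also have "\<dots> \<le> r * (ps * E) * exp (2 * b) + (K * (C * r * (ps * E)) * exp (2 * b) + r * (ps * E) * exp (2 * b))"
  proof (intro add_mono order_refl)
    have e: "x \<le> x * exp (2 * b)" if "0 \<le> x" for x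
      using that b mult_left_mono[of 1 "exp (2 * b)" x] by simp
    show "r * (ps * E) \<le> r * (ps * E) * exp (2 * b)"
      using ps0 E r by (intro e mult_nonneg_nonneg) auto
    show "K * (C * r * (ps * E)) \<le> K * (C * r * (ps * E)) * exp (2 * b)"
      using ps0 E r C by (intro e mult_nonneg_nonneg) auto
  qed
  also have "\<dots> = ps * (G * r)"
  proof -
    have eG: "exp (b * (d + 2)) = E * exp (2 * b)" by (simp add: E_def algebra_simps flip: exp_add)
    show ?thesis unfolding G_def eG by (simp add: algebra_simps)
  qed
  finally have "\<bar>p - ps\<bar> \<le> ps * (G * r)" .
  moreover have "p / ps - 1 = (p - ps) / ps" using ps0 by (simp add: diff_divide_distrib)
  ultimately show "\<bar>p / ps - 1\<bar> \<le> G * r"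
    using ps0 by (simp add: abs_divide pos_divide_le_eq mult.commute)
  have "E \<le> exp (b * (d + 2))" unfolding E_def exp_le_cancel_iff using b by (intro mult_left_mono) auto
  also have "\<dots> \<le> G" unfolding G_def using C mult_right_mono[of 1 "K * C + 2" "exp (b * (d + 2))"] by simp
  finally have "1 / G \<le> 1 / E" using E by (intro divide_left_mono) auto
  also have "1 / E \<le> p / ps" using low ps0 by (simp add: pos_le_divide_eq)
  finally show "1 / G \<le> p / ps" .
qed

lemma integrable_lborel_translate_iff:
  fixes f :: "'a::euclidean_space \<Rightarrow> real"
  assumes "f \<in> borel_measurable borel"
  shows "integrable lborel (\<lambda>x. f (x - a)) \<longleftrightarrow> integrable lborel f"
  using integrable_distr_eq[of "(+) (- a)" lborel borel f] assms by (simp add: lborel_distr_plus)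

text \<open>
  Translating by \<open>a\<close> moves the shift from \<open>f\<close> to the weight, and \<open>(1 + L + norm (y + a)) powr \<gamma>\<close> is at
  most a constant times \<open>1 + norm y powr \<gamma>\<close>. The constant enlarges \<open>M\<close>, which is why exponential
  moments of every order are assumed.
\<close>

lemma integrable_exp_envelope_shift:
  fixes f :: "'a::euclidean_space \<Rightarrow> real"
  assumes f[measurable]: "f \<in> borel_measurable borel" and f0: "\<And>x. 0 \<le> f x" and \<gamma>: "0 \<le> \<gamma>" and L: "norm a \<le> L" and M: "0 < M"
    and int: "\<And>M. 0 < M \<Longrightarrow> integrable lborel (\<lambda>x. exp (M * norm x powr \<gamma>) * f x)"
  shows "integrable lborel (\<lambda>x. exp (M * (1 + L + norm x) powr \<gamma>) * f (x - a))"
proof -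
  define c where "c = (2 * (1 + 2 * L)) powr \<gamma>"
  have L0: "0 \<le> L" using L norm_ge_zero[of a] by linarith
  have c: "0 < c" using L0 by (simp add: c_def)
  have env: "(1 + L + norm (y + a)) powr \<gamma> \<le> c * (1 + norm y powr \<gamma>)" for y
  proof -
    have "1 + L + norm (y + a) \<le> (1 + 2 * L) * (1 + norm y)"
      using norm_triangle_ineq[of y a] L mult_nonneg_nonneg[OF L0 norm_ge_zero[of y]]
      by (simp add: distrib_left distrib_right)
    \<comment> \<open>The maximum covers \<open>norm y = 0\<close>, where \<open>norm y powr \<gamma>\<close> is \<open>0\<close> even for \<open>\<gamma> = 0\<close>.\<close>
    also have "\<dots> \<le> (1 + 2 * L) * (2 * max 1 (norm y))"
      using L0 by (intro mult_left_mono) auto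
    also have "\<dots> = 2 * (1 + 2 * L) * max 1 (norm y)" by simp
    finally have "(1 + L + norm (y + a)) powr \<gamma> \<le> (2 * (1 + 2 * L) * max 1 (norm y)) powr \<gamma>"
      using L0 \<gamma> by (intro powr_mono2) auto
    also have "\<dots> = c * max 1 (norm y) powr \<gamma>"
      using L0 by (simp add: c_def powr_mult)
    also have "max 1 (norm y) powr \<gamma> \<le> 1 + norm y powr \<gamma>"
      by (simp add: max_def)
    finally show ?thesis using c by simp
  qed
  have "integrable lborel (\<lambda>y. exp (M * (1 + L + norm (y + a)) powr \<gamma>) * f y)"
  proof (rule Bochner_Integration.integrable_bound)
    show "integrable lborel (\<lambda>y. exp (M * c) * (exp (M * c * norm y powr \<gamma>) * f y))"
      by (intro integrable_mult_right int mult_pos_pos M c)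
    show "AE y in lborel. norm (exp (M * (1 + L + norm (y + a)) powr \<gamma>) * f y)
        \<le> norm (exp (M * c) * (exp (M * c * norm y powr \<gamma>) * f y))"
    proof (rule AE_I2)
      fix y
      have "M * (1 + L + norm (y + a)) powr \<gamma> \<le> M * (c * (1 + norm y powr \<gamma>))"
        using env[of y] M by (intro mult_left_mono) auto
      then have "exp (M * (1 + L + norm (y + a)) powr \<gamma>) \<le> exp (M * c) * exp (M * c * norm y powr \<gamma>)"
        unfolding exp_add[symmetric] exp_le_cancel_iff by (simp only: distrib_left mult_1_right mult.assoc)
      then have "exp (M * (1 + L + norm (y + a)) powr \<gamma>) * f y \<le> exp (M * c) * exp (M * c * norm y powr \<gamma>) * f y"
        using f0 by (intro mult_right_mono)
      then show "norm (exp (M * (1 + L + norm (y + a)) powr \<gamma>) * f y)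
        \<le> norm (exp (M * c) * (exp (M * c * norm y powr \<gamma>) * f y))"
        using f0[of y] by (simp add: abs_mult mult_ac)
    qed
  qed measurable
  then show ?thesis
    using integrable_lborel_translate_iff[of "\<lambda>y. exp (M * (1 + L + norm (y + a)) powr \<gamma>) * f y" a] by simp
qed

section \<open>Mass that the prior gives to a neighbourhood of the true mixing measure\<close>

lemma stick_weight_nonneg: "(\<And>j. v j \<in> {0<..<1}) \<Longrightarrow> 0 \<le> stick_weight v k"
  unfolding stick_weight_def by (intro mult_nonneg_nonneg prod_nonneg) (auto simp: less_imp_le)

lemma sum_stick_weight: "(\<Sum>k<n. stick_weight v k) = 1 - (\<Prod>j<n. 1 - v j)"
  by (induction n) (simp_all add: stick_weight_def algebra_simps)

text \<open>
  A weight is a product of numbers in the unit interval, and such a product is 1-Lipschitz in each factor.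
\<close>

lemma stick_weight_diff_le:
  assumes "\<And>j. j \<le> k \<Longrightarrow> v j \<in> {0..1} \<and> u j \<in> {0..1} \<and> \<bar>v j - u j\<bar> \<le> r"
  shows "\<bar>stick_weight v k - stick_weight u k\<bar> \<le> real (Suc k) * r"
proof -
  define z where "z x j = (if j = k then x j else 1 - x j)" for x :: "nat \<Rightarrow> real" and j
  have eq: "stick_weight x k = (\<Prod>j\<le>k. z x j)" for x
    by (simp add: stick_weight_def z_def lessThan_Suc_atMost[symmetric] mult.commute)
  have "norm ((\<Prod>j\<le>k. z v j) - (\<Prod>j\<le>k. z u j)) \<le> (\<Sum>j\<le>k. norm (z v j - z u j))"
    using assms by (intro norm_prod_diff) (auto simp: z_def)
  also have "\<dots> \<le> (\<Sum>j\<le>k. r)"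
    using assms by (intro sum_mono) (force simp: z_def)
  finally show ?thesis by (simp add: eq)
qed

text \<open>
  The inverse of stick breaking: each stick is the fraction that its weight takes of the mass left
  over by its predecessors. If \<open>K\<close> positive weights sum to \<open>1\<close>, the last stick takes all that is left.
\<close>

definition sticks_of :: "(nat \<Rightarrow> real) \<Rightarrow> nat \<Rightarrow> real" where
  "sticks_of w k = w k / (1 - (\<Sum>j<k. w j))"

lemma sticks_of:
  assumes w: "\<And>k. k < K \<Longrightarrow> 0 < w k" "(\<Sum>k<K. w k) = 1"
  shows "k < K \<Longrightarrow> stick_weight (sticks_of w) k = w k"
    and "Suc k < K \<Longrightarrow> sticks_of w k \<in> {0<..<1}"
    and "Suc k = K \<Longrightarrow> sticks_of w k = 1"
proof -
  have lt: "(\<Sum>j<k. w j) < 1" if "k < K" for k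
  proof -
    have "(\<Sum>j<k. w j) < (\<Sum>j<K. w j)"
      using that w(1) by (intro sum_strict_mono2[where b = k]) (auto intro: less_imp_le)
    then show ?thesis by (simp add: w(2))
  qed
  have rest: "(\<Prod>j<k. 1 - sticks_of w j) = 1 - (\<Sum>j<k. w j)" if "k < K" for k
    using that
  proof (induction k)
    case (Suc k)
    then have "(\<Prod>j<k. 1 - sticks_of w j) = 1 - (\<Sum>j<k. w j)" by simp
    then show ?case using lt[of k] Suc.prems by simp (simp add: sticks_of_def field_simps)
  qed simp
  show "stick_weight (sticks_of w) k = w k" if "k < K"
    using rest[OF that] lt[OF that] by (simp add: stick_weight_def sticks_of_def)
  show "sticks_of w k \<in> {0<..<1}" if "Suc k < K"
    using lt[OF that] lt[of k] w(1)[of k] that by (simp add: sticks_of_def field_simps)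
  show "sticks_of w k = 1" if "Suc k = K"
    using w that lt[of k] by (auto simp: sticks_of_def)
qed

text \<open>
  For \<open>Beta(1,\<alpha>)\<close> the density is a multiple of \<open>(1 - x) powr (\<alpha> - 1)\<close>, so a lower bound on this power on an
  interval bounds the mass of the interval.
\<close>

lemma beta_measure_interval:
  assumes \<alpha>: "0 < \<alpha>" and ab: "0 < a" "a \<le> b" "b < 1" and m: "\<And>x. a \<le> x \<Longrightarrow> x \<le> b \<Longrightarrow> m \<le> (1 - x) powr (\<alpha> - 1)" "0 \<le> m"
  shows "m * (b - a) / Beta 1 \<alpha> \<le> measure (beta_measure 1 \<alpha>) {a..b}"
proof -
  interpret prob_space "beta_measure 1 \<alpha>" using \<alpha> by (intro prob_space_beta_measure) auto
  have B: "0 < Beta 1 \<alpha>" using \<alpha> by (simp add: Beta_def Gamma_real_pos)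
  have "ennreal (m * (b - a) / Beta 1 \<alpha>) = (\<integral>\<^sup>+x. ennreal (m / Beta 1 \<alpha>) * indicator {a..b} x \<partial>lborel)"
    using ab m B by (simp add: nn_integral_cmult_indicator ennreal_mult[symmetric])
  also have "\<dots> \<le> (\<integral>\<^sup>+x. ennreal (x powr (1 - 1) * (1 - x) powr (\<alpha> - 1) / Beta 1 \<alpha> * indicator {0<..<1} x) * indicator {a..b} x \<partial>lborel)"
    using ab m B by (intro nn_integral_mono) (auto simp: indicator_def intro!: ennreal_leI divide_right_mono)
  also have "\<dots> = emeasure (beta_measure 1 \<alpha>) {a..b}"
    unfolding beta_measure_def by (subst emeasure_density) auto
  finally show ?thesis
    by (simp add: emeasure_eq_measure)
qed

text \<open>
  The density is bounded below near an interior point. The exponent \<open>\<bar>\<alpha> - 1\<bar>\<close> in the proof serves both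
  \<open>\<alpha> \<ge> 1\<close> and \<open>\<alpha> < 1\<close>, as the base is at most \<open>1\<close>.
\<close>

lemma beta_measure_near:
  assumes \<alpha>: "0 < \<alpha>" and u: "u \<in> {0<..<1}"
  shows "\<exists>c>0. \<forall>r. 0 < r \<and> r \<le> 1 \<longrightarrow> c * r \<le> measure (beta_measure 1 \<alpha>) {x. \<bar>x - u\<bar> \<le> r}"
proof -
  interpret prob_space "beta_measure 1 \<alpha>" using \<alpha> by (intro prob_space_beta_measure) auto
  have B: "0 < Beta 1 \<alpha>" using \<alpha> by (simp add: Beta_def Gamma_real_pos)
  define \<delta> where "\<delta> = min u (1 - u) / 2"
  define m where "m = min 1 ((1 - u) / 2) powr \<bar>\<alpha> - 1\<bar>"
  have \<delta>: "0 < \<delta>" "\<delta> \<le> u / 2" "\<delta> \<le> (1 - u) / 2" "\<delta> \<le> 1" using u by (auto simp: \<delta>_def)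
  have m: "0 < m" using u by (simp add: m_def)
  have dens: "m \<le> (1 - x) powr (\<alpha> - 1)" if "u - \<delta> \<le> x" "x \<le> u + \<delta>" for x
  proof -
    have x: "(1 - u) / 2 \<le> 1 - x" "1 - x \<le> 1" using that \<delta> u by (auto simp: field_simps)
    have "m \<le> (1 - x) powr \<bar>\<alpha> - 1\<bar>" unfolding m_def using x u by (intro powr_mono2) auto
    also have "\<dots> \<le> (1 - x) powr (\<alpha> - 1)" using x u by (intro powr_mono') auto
    finally show ?thesis .
  qed
  have "m * \<delta> / Beta 1 \<alpha> * r \<le> measure (beta_measure 1 \<alpha>) {x. \<bar>x - u\<bar> \<le> r}" if r: "0 < r" "r \<le> 1" for r
  proof -
    define s where "s = \<delta> * r"
    have \<delta>r: "s \<le> \<delta>" "s \<le> r" "0 < s"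
      unfolding s_def using \<delta> r by (simp_all add: mult_left_le mult_left_le_one_le)
    have "m * \<delta> / Beta 1 \<alpha> * r \<le> m * ((u + s) - u) / Beta 1 \<alpha>" by (simp add: s_def)
    also have "\<dots> \<le> measure (beta_measure 1 \<alpha>) {u..u + s}"
      using \<delta>r \<delta> u m dens by (intro beta_measure_interval \<alpha>) auto
    also have "\<dots> \<le> measure (beta_measure 1 \<alpha>) {x. \<bar>x - u\<bar> \<le> r}"
      using \<delta>r r by (intro finite_measure_mono) auto
    finally show ?thesis .
  qed
  moreover have "0 < m * \<delta> / Beta 1 \<alpha>" using m \<delta> B by simp
  ultimately show ?thesis by blast
qed

text \<open>
  At the end point \<open>1\<close> the density behaves like \<open>(1 - x) powr (\<alpha> - 1)\<close>, so the mass is of order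
  \<open>r powr \<alpha>\<close> and not \<open>r\<close>. The interval from \<open>1 - r / 2\<close> to \<open>1 - r / 4\<close> already carries this order, and on
  it \<open>(1 - x) / r\<close> is at least \<open>1 / 4\<close>.
\<close>

lemma beta_measure_near_one:
  assumes \<alpha>: "0 < \<alpha>"
  shows "\<exists>c>0. \<forall>r. 0 < r \<and> r \<le> 1 \<longrightarrow> c * r powr \<alpha> \<le> measure (beta_measure 1 \<alpha>) {x. \<bar>x - 1\<bar> \<le> r}"
proof -
  interpret prob_space "beta_measure 1 \<alpha>" using \<alpha> by (intro prob_space_beta_measure) auto
  have B: "0 < Beta 1 \<alpha>" using \<alpha> by (simp add: Beta_def Gamma_real_pos)
  define m :: real where "m = (1 / 4) powr \<bar>\<alpha> - 1\<bar>"
  have m: "0 < m" by (simp add: m_def)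
  have "m / (4 * Beta 1 \<alpha>) * r powr \<alpha> \<le> measure (beta_measure 1 \<alpha>) {x. \<bar>x - 1\<bar> \<le> r}" if r: "0 < r" "r \<le> 1" for r
  proof -
    have dens: "m * r powr (\<alpha> - 1) \<le> (1 - x) powr (\<alpha> - 1)" if x: "1 - r / 2 \<le> x" "x \<le> 1 - r / 4" for x
    proof -
      have "m \<le> ((1 - x) / r) powr \<bar>\<alpha> - 1\<bar>" unfolding m_def using x r by (intro powr_mono2) (auto simp: field_simps)
      also have "\<dots> \<le> ((1 - x) / r) powr (\<alpha> - 1)" using x r by (intro powr_mono') (auto simp: field_simps)
      finally have "m * r powr (\<alpha> - 1) \<le> ((1 - x) / r) powr (\<alpha> - 1) * r powr (\<alpha> - 1)"
        by (intro mult_right_mono) auto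
      also have "\<dots> = (1 - x) powr (\<alpha> - 1)" using x r by (simp flip: powr_mult)
      finally show ?thesis .
    qed
    have "m / (4 * Beta 1 \<alpha>) * r powr \<alpha> = m * r powr (\<alpha> - 1) * ((1 - r / 4) - (1 - r / 2)) / Beta 1 \<alpha>"
      using r by (simp add: powr_diff field_simps)
    also have "\<dots> \<le> measure (beta_measure 1 \<alpha>) {1 - r / 2..1 - r / 4}"
      using r m dens by (intro beta_measure_interval \<alpha>) auto
    also have "\<dots> \<le> measure (beta_measure 1 \<alpha>) {x. \<bar>x - 1\<bar> \<le> r}"
      using r by (intro finite_measure_mono) auto
    finally show ?thesis .
  qed
  moreover have "0 < m / (4 * Beta 1 \<alpha>)" using m B by simp
  ultimately show ?thesis by blast
qed

text \<open>
  Near \<open>z\<close> the density exceeds \<open>p0 z / 2\<close> on \<open>\<Theta>\<close>, and \<open>\<Theta>\<close> fills a fixed fraction of every small ball. Shrinking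
  the ball by the factor \<open>\<delta>\<close> makes the estimate valid for all radii up to \<open>1\<close>.
\<close>

lemma density_ball_mass:
  fixes p0 :: "'a::euclidean_space \<Rightarrow> real"
  assumes P0: "prob_space (density lborel (\<lambda>x. ennreal (p0 x * indicator \<Theta> x)))"
    and \<Theta>: "compact \<Theta>" "z \<in> \<Theta>" and p0: "continuous_on \<Theta> p0" "\<And>x. x \<in> \<Theta> \<Longrightarrow> 0 \<le> p0 x" "0 < p0 z" and fat: "fat_at \<Theta> z"
  shows "\<exists>c>0. \<forall>r. 0 < r \<and> r \<le> 1 \<longrightarrow>
    c * r ^ DIM('a) \<le> measure (density lborel (\<lambda>x. ennreal (p0 x * indicator \<Theta> x))) (ball z r)"
proof -
  let ?P = "density lborel (\<lambda>x. ennreal (p0 x * indicator \<Theta> x))"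
  interpret prob_space ?P by fact
  have \<Theta>s[measurable]: "\<Theta> \<in> sets borel" using \<Theta>(1) by (simp add: borel_compact)
  have meas[measurable]: "(\<lambda>x. p0 x * indicator \<Theta> x) \<in> borel_measurable borel"
    using borel_measurable_continuous_on_indicator[OF \<Theta>s p0(1)] by (simp add: mult.commute)
  obtain \<delta>' where \<delta>': "0 < \<delta>'" "\<And>x. x \<in> \<Theta> \<Longrightarrow> dist x z < \<delta>' \<Longrightarrow> dist (p0 x) (p0 z) < p0 z / 2"
    using p0(1,3) \<Theta>(2) unfolding continuous_on_iff by (meson half_gt_zero)
  define \<delta> where "\<delta> = min \<delta>' 1"
  have \<delta>: "0 < \<delta>" "\<delta> \<le> 1" using \<delta>' by (auto simp: \<delta>_def)
  have low: "p0 z / 2 \<le> p0 x" if "x \<in> \<Theta>" "dist x z < \<delta>" for x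
    using \<delta>'(2)[of x] that by (simp add: \<delta>_def dist_real_def abs_if split: if_splits)
  obtain \<kappa> where \<kappa>: "0 < \<kappa>"
    "\<And>r. 0 < r \<Longrightarrow> r \<le> 1 \<Longrightarrow> \<kappa> * measure lborel (ball z r) \<le> measure lborel (\<Theta> \<inter> ball z r)"
    using fat unfolding fat_at_def by blast
  define V where "V = measure lborel (ball (0::'a) 1)"
  have V: "0 < V" using content_ball_pos[of 1 "0::'a"] by (simp add: V_def)
  have "p0 z / 2 * \<kappa> * \<delta> ^ DIM('a) * V * r ^ DIM('a) \<le> measure ?P (ball z r)" if r: "0 < r" "r \<le> 1" for r
  proof -
    have \<delta>r: "\<delta> * r \<le> \<delta>" "\<delta> * r \<le> r" "0 < \<delta> * r" "\<delta> * r \<le> 1"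
      using \<delta> r mult_left_le[of r \<delta>] mult_left_le_one_le[of r \<delta>] by (simp_all add: mult_le_one)
    let ?S = "\<Theta> \<inter> ball z (\<delta> * r)"
    have fin: "emeasure lborel ?S < \<infinity>"
      by (rule le_less_trans[OF emeasure_mono emeasure_lborel_ball_finite[of z "\<delta> * r"]]) auto
    have "p0 z / 2 * \<kappa> * \<delta> ^ DIM('a) * V * r ^ DIM('a) = p0 z / 2 * (\<kappa> * measure lborel (ball z (\<delta> * r)))"
      using \<delta>r(3) by (simp add: content_ball_conv_unit_ball[of "\<delta> * r" z] V_def power_mult_distrib)
    also have "\<dots> \<le> p0 z / 2 * measure lborel ?S"
      using \<kappa>(2)[of "\<delta> * r"] \<delta>r p0(3) by (intro mult_left_mono) auto
    finally have 1: "p0 z / 2 * \<kappa> * \<delta> ^ DIM('a) * V * r ^ DIM('a) \<le> p0 z / 2 * measure lborel ?S" .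
    have "ennreal (p0 z / 2 * measure lborel ?S) = (\<integral>\<^sup>+x. ennreal (p0 z / 2) * indicator ?S x \<partial>lborel)"
      using fin p0(3) by (simp add: nn_integral_cmult_indicator ennreal_mult[symmetric] emeasure_eq_ennreal_measure less_top)
    also have "\<dots> \<le> (\<integral>\<^sup>+x. ennreal (p0 x * indicator \<Theta> x) * indicator (ball z r) x \<partial>lborel)"
    proof (rule nn_integral_mono)
      fix x
      show "ennreal (p0 z / 2) * indicator ?S x \<le> ennreal (p0 x * indicator \<Theta> x) * indicator (ball z r) x"
      proof (cases "x \<in> ?S")
        case True
        then have "dist x z < \<delta>" "x \<in> ball z r" using \<delta>r by (auto simp: dist_commute)
        then show ?thesis using True low[of x] by (auto simp: ennreal_leI)
      qed auto
    qed
    also have "\<dots> = emeasure ?P (ball z r)"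
      by (subst emeasure_density) auto
    finally have "p0 z / 2 * measure lborel ?S \<le> measure ?P (ball z r)"
      by (simp add: emeasure_eq_measure)
    with 1 show ?thesis by linarith
  qed
  moreover have "0 < p0 z / 2 * \<kappa> * \<delta> ^ DIM('a) * V" using p0(3) \<kappa>(1) \<delta>(1) V by simp
  ultimately show ?thesis by blast
qed

lemma AE_beta_measure: "AE x in beta_measure a b. x \<in> {0<..<1}"
  unfolding beta_measure_def by (subst AE_density) (auto intro!: AE_I2 simp: indicator_def)

text \<open>
  The mass left after \<open>n\<close> sticks is the product of \<open>n\<close> independent factors with the same mean \<open>q < 1\<close>, so its
  expectation \<open>q ^ n\<close> tends to \<open>0\<close>. It decreases in \<open>n\<close>, hence its limit vanishes almost surely.
\<close>

lemma AE_stick_weights_sum: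
  assumes \<alpha>: "0 < \<alpha>"
  shows "AE v in PiM UNIV (\<lambda>_::nat. beta_measure 1 \<alpha>). stick_weight v sums 1"
proof -
  let ?B = "beta_measure 1 \<alpha>" and ?M = "PiM UNIV (\<lambda>_::nat. beta_measure 1 \<alpha>)"
  interpret B: prob_space ?B using \<alpha> by (intro prob_space_beta_measure) auto
  interpret PB: product_prob_space "\<lambda>_::nat. ?B" UNIV by unfold_locales
  have in01: "AE v in ?M. \<forall>j. v j \<in> {0<..<1}"
    unfolding AE_all_countable
    by (intro allI AE_PiM_component[where P = "\<lambda>x. x \<in> {0<..<1}"] AE_beta_measure B.prob_space_axioms) auto
  define q where "q = (\<integral>\<^sup>+x. ennreal (1 - x) * indicator {0<..<1} x \<partial>?B)"
  have [measurable]: "{0<..<1} \<in> sets (borel :: real measure)" by simp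
  have q: "q < 1"
  proof -
    have "q < (\<integral>\<^sup>+x. 1 \<partial>?B)"
      unfolding q_def
    proof (rule nn_integral_less)
      show "(\<integral>\<^sup>+x. ennreal (1 - x) * indicator {0<..<1} x \<partial>?B) \<noteq> \<infinity>"
      proof -
        have "(\<integral>\<^sup>+x. ennreal (1 - x) * indicator {0<..<1} x \<partial>?B) \<le> (\<integral>\<^sup>+x. 1 \<partial>?B)"
          by (intro nn_integral_mono) (auto simp: indicator_def ennreal_le_1)
        also have "\<dots> = 1" using B.emeasure_space_1 by simp
        finally show ?thesis by (auto simp: top_unique)
      qed
      show "AE x in ?B. ennreal (1 - x) * indicator {0<..<1} x \<le> 1"
        by (intro AE_I2) (auto simp: indicator_def ennreal_le_1)
      show "\<not> (AE x in ?B. 1 \<le> ennreal (1 - x) * indicator {0<..<1} x)"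
      proof
        assume "AE x in ?B. 1 \<le> ennreal (1 - x) * indicator {0<..<1} x"
        then have "AE x in ?B. False"
          using AE_beta_measure[of 1 \<alpha>] by eventually_elim (auto simp: ennreal_ge_1)
        then show False by simp
      qed
    qed simp_all
    then show ?thesis using B.emeasure_space_1 by simp
  qed
  have prod_mean: "(\<integral>\<^sup>+v. (\<Prod>j<n. ennreal (1 - v j) * indicator {0<..<1} (v j)) \<partial>?M) = q ^ n" for n
  proof -
    have "(\<integral>\<^sup>+v. (\<Prod>j<n. ennreal (1 - v j) * indicator {0<..<1} (v j)) \<partial>?M)
        = (\<integral>\<^sup>+v. (\<Prod>j<n. ennreal (1 - v j) * indicator {0<..<1} (v j)) \<partial>distr ?M (PiM {..<n} (\<lambda>_. ?B)) (\<lambda>v. restrict v {..<n}))"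
      by (subst nn_integral_distr) (auto intro!: nn_integral_cong prod.cong measurable_restrict_subset)
    also have "distr ?M (PiM {..<n} (\<lambda>_. ?B)) (\<lambda>v. restrict v {..<n}) = PiM {..<n} (\<lambda>_. ?B)"
      by (rule PB.distr_PiM_restrict_finite) auto
    also have "(\<integral>\<^sup>+v. (\<Prod>j<n. ennreal (1 - v j) * indicator {0<..<1} (v j)) \<partial>PiM {..<n} (\<lambda>_. ?B)) = q ^ n"
      by (subst PB.product_nn_integral_prod) (auto simp: q_def)
    finally show ?thesis .
  qed
  define rest where "rest v n = (\<Prod>j<n. 1 - v j)" for v :: "nat \<Rightarrow> real" and n
  define lim where "lim v = (INF n. (\<Prod>j<n. ennreal (1 - v j) * indicator {0<..<1} (v j)))" for v :: "nat \<Rightarrow> real"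
  have lim_meas[measurable]: "lim \<in> borel_measurable ?M"
    unfolding lim_def by measurable
  have "(\<integral>\<^sup>+v. lim v \<partial>?M) \<le> q ^ n" for n
    unfolding prod_mean[symmetric] lim_def by (intro nn_integral_mono INF_lower) auto
  moreover have "(\<lambda>n. q ^ n) \<longlonglongrightarrow> 0"
  proof -
    obtain p where p: "0 \<le> p" "q = ennreal p" using q by (cases q) auto
    then have "(\<lambda>n. ennreal (p ^ n)) \<longlonglongrightarrow> ennreal 0"
      using q by (intro tendsto_ennrealI LIMSEQ_realpow_zero) (auto simp: ennreal_less_one_iff)
    then show ?thesis using p by (simp add: ennreal_power)
  qed
  ultimately have "(\<integral>\<^sup>+v. lim v \<partial>?M) \<le> 0"
    by (intro LIMSEQ_le_const) auto
  then have "AE v in ?M. lim v = 0"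
    by (subst (asm) le_zero_eq, subst (asm) nn_integral_0_iff_AE) auto
  with in01 show ?thesis
  proof eventually_elim
    case (elim v)
    have v: "0 < v j" "v j < 1" for j using elim(1) by auto
    have eq: "(\<Prod>j<n. ennreal (1 - v j) * indicator {0<..<1} (v j)) = ennreal (rest v n)" for n
      using v by (simp add: rest_def prod_ennreal less_imp_le)
    have dec: "decseq (rest v)"
      unfolding decseq_Suc_iff rest_def using v
      by (auto intro!: mult_right_le_one_le prod_nonneg simp: less_imp_le)
    then have "decseq (\<lambda>n. ennreal (rest v n))"
      by (auto simp: decseq_def intro!: ennreal_leI)
    from LIMSEQ_INF[OF this] have "(\<lambda>n. ennreal (rest v n)) \<longlonglongrightarrow> ennreal 0"
      using elim(2) by (simp add: lim_def eq)
    then have "rest v \<longlonglongrightarrow> 0"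
      by (rule tendsto_ennrealD) (use v in \<open>auto simp: rest_def intro!: prod_pos always_eventually less_imp_le\<close>)
    from tendsto_diff[OF tendsto_const this, of 1] show ?case
      by (simp add: sums_def sum_stick_weight rest_def)
  qed
qed

text \<open>
  Independent coordinates multiply their masses, so their orders of magnitude in \<open>r\<close> add up in the exponent.
\<close>

lemma prod_powr_lower:
  fixes m :: "nat \<Rightarrow> real \<Rightarrow> real"
  assumes "\<And>j. j < K \<Longrightarrow> \<exists>c>0. \<forall>r. 0 < r \<and> r \<le> 1 \<longrightarrow> c * r powr e j \<le> m j r"
  shows "\<exists>c>0. \<forall>r. 0 < r \<and> r \<le> 1 \<longrightarrow> c * r powr (\<Sum>j<K. e j) \<le> (\<Prod>j<K. m j r)"
proof -
  obtain c where c: "\<And>j. j < K \<Longrightarrow> 0 < c j"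
    "\<And>j r. j < K \<Longrightarrow> 0 < r \<Longrightarrow> r \<le> 1 \<Longrightarrow> c j * r powr e j \<le> m j r"
    using assms by metis
  have "(\<Prod>j<K. c j) * r powr (\<Sum>j<K. e j) \<le> (\<Prod>j<K. m j r)" if "0 < r" "r \<le> 1" for r
  proof -
    have "(\<Prod>j<K. c j) * r powr (\<Sum>j<K. e j) = (\<Prod>j<K. c j * r powr e j)"
      using that by (simp add: powr_sum prod.distrib)
    also have "\<dots> \<le> (\<Prod>j<K. m j r)"
      using c that by (intro prod_mono) (auto simp: less_imp_le)
    finally show ?thesis .
  qed
  moreover have "0 < (\<Prod>j<K. c j)" using c by (intro prod_pos) auto
  ultimately show ?thesis by blast
qed

text \<open>
  A null set can be removed from a cylinder without changing its mass; almost sure properties of the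
  sequence then hold everywhere on what remains.
\<close>

lemma cylinder_inter_AE:
  fixes K :: nat
  assumes M: "prob_space M" and S: "\<And>j. j < K \<Longrightarrow> S j \<in> sets M" and P: "AE v in PiM UNIV (\<lambda>_::nat. M). P v"
  shows "\<exists>C\<in>sets (PiM UNIV (\<lambda>_::nat. M)). (\<forall>v\<in>C. P v \<and> (\<forall>j<K. v j \<in> S j))
    \<and> measure (PiM UNIV (\<lambda>_::nat. M)) C = (\<Prod>j<K. measure M (S j))"
proof -
  let ?M = "PiM UNIV (\<lambda>_::nat. M)"
  interpret M: prob_space M by fact
  interpret PM: product_prob_space "\<lambda>_::nat. M" UNIV by unfold_locales
  obtain N where N: "{v \<in> space ?M. \<not> P v} \<subseteq> N" "N \<in> null_sets ?M"
    using P unfolding eventually_ae_filter by (elim bexE)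
  define C where "C = {v \<in> space ?M. \<forall>j\<in>{..<K}. v j \<in> S j}"
  have C: "C \<in> sets ?M"
    unfolding C_def
  proof (rule sets.sets_Collect_finite_All)
    fix j assume "j \<in> {..<K}"
    then have "(\<lambda>v. v j) -` S j \<inter> space ?M \<in> sets ?M"
      by (intro measurable_sets[OF measurable_component_singleton] S) auto
    also have "(\<lambda>v. v j) -` S j \<inter> space ?M = {v \<in> space ?M. v j \<in> S j}" by blast
    finally show "{v \<in> space ?M. v j \<in> S j} \<in> sets ?M" .
  qed simp
  have "emeasure ?M C = (\<Prod>j<K. emeasure M (S j))"
    unfolding C_def using S by (intro PM.emeasure_PiM_Collect) auto
  then have "measure ?M C = (\<Prod>j<K. measure M (S j))"
    by (simp add: M.emeasure_eq_measure PM.P.emeasure_eq_measure prod_ennreal prod_nonneg)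
  then have "measure ?M (C - N) = (\<Prod>j<K. measure M (S j))"
    using measure_Diff_null_set[OF C N(2)] by simp
  moreover have "C - N \<in> sets ?M" using C N(2) by auto
  ultimately show ?thesis
    using N(1) by (intro bexI[of _ "C - N"] conjI ballI allI impI) (auto simp: C_def)
qed

text \<open>
  Parameters of discrete measures that are within order \<open>r\<close> of the \<open>K\<close>-point measure with weights \<open>ws\<close> and atoms \<open>\<theta>s\<close>:
  the first \<open>K\<close> weights and atoms match, and the atoms of the remaining mass, at most \<open>r\<close>, are free in \<open>\<Theta>\<close>.
\<close>

definition near_sticks ::
    "'a::euclidean_space set \<Rightarrow> nat \<Rightarrow> (nat \<Rightarrow> real) \<Rightarrow> (nat \<Rightarrow> 'a) \<Rightarrow> real \<Rightarrow> ((nat \<Rightarrow> real) \<times> (nat \<Rightarrow> 'a)) set" where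
  "near_sticks \<Theta> K ws \<theta>s r = {(v, \<theta>). (\<forall>j. v j \<in> {0<..<1}) \<and> stick_weight v sums 1 \<and> (\<forall>k. \<theta> k \<in> \<Theta>) \<and>
    (\<forall>k<K. \<bar>stick_weight v k - ws k\<bar> \<le> real K * r \<and> norm (\<theta> k - \<theta>s k) \<le> r) \<and>
    1 - (\<Sum>k<K. stick_weight v k) \<le> r}"

text \<open>
  The exponent counts the constraints. Each of the \<open>K\<close> atoms lies in a ball of radius \<open>r\<close> and contributes the
  dimension; each of the first \<open>K - 1\<close> sticks lies in an interval of length of order \<open>r\<close> inside the unit
  interval and contributes \<open>1\<close>; the last stick lies within \<open>r\<close> of the end point \<open>1\<close> and contributes \<open>\<alpha>\<close>.
  Closeness of the last stick to \<open>1\<close> is what makes the remaining mass at most \<open>r\<close>.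
\<close>

lemma prior_mass_near_mixing_measure:
  fixes p0 :: "'a::euclidean_space \<Rightarrow> real" and ws :: "nat \<Rightarrow> real" and \<theta>s :: "nat \<Rightarrow> 'a"
  assumes \<alpha>: "0 < \<alpha>" and ws: "\<And>k. k < K \<Longrightarrow> 0 < ws k" "(\<Sum>k<K. ws k) = 1"
    and P0: "prob_space P0" "P0 = density lborel (\<lambda>x. ennreal (p0 x * indicator \<Theta> x))"
    and \<Theta>: "compact \<Theta>" "\<And>k. k < K \<Longrightarrow> \<theta>s k \<in> \<Theta>"
    and p0: "continuous_on \<Theta> p0" "\<And>x. x \<in> \<Theta> \<Longrightarrow> 0 \<le> p0 x" "\<And>k. k < K \<Longrightarrow> 0 < p0 (\<theta>s k)"
    and fat: "\<And>k. k < K \<Longrightarrow> fat_at \<Theta> (\<theta>s k)"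
  defines "M \<equiv> PiM UNIV (\<lambda>_::nat. beta_measure 1 \<alpha>) \<Otimes>\<^sub>M PiM UNIV (\<lambda>_::nat. P0)"
  shows "\<exists>c>0. \<forall>r. 0 < r \<and> r \<le> 1 \<longrightarrow> (\<exists>A\<in>sets M.
      c * r powr (real K * DIM('a) + (real K - 1) + \<alpha>) \<le> measure M A \<and>
      A \<subseteq> near_sticks \<Theta> K ws \<theta>s r)"
proof -
  let ?B = "beta_measure 1 \<alpha>"
  let ?u = "sticks_of ws"
  interpret B: prob_space ?B using \<alpha> by (intro prob_space_beta_measure) auto
  interpret P0: prob_space P0 by fact
  interpret PB: product_prob_space "\<lambda>_::nat. ?B" UNIV by unfold_locales
  interpret PP: product_prob_space "\<lambda>_::nat. P0" UNIV by unfold_locales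
  have st: "k < K \<Longrightarrow> stick_weight ?u k = ws k" "Suc k < K \<Longrightarrow> ?u k \<in> {0<..<1}" "Suc k = K \<Longrightarrow> ?u k = 1" for k
    by (rule sticks_of[OF ws]; assumption)+
  have K: "0 < K" using ws(2) by (cases K) auto
  define e where "e j = (if Suc j < K then 1 else \<alpha>)" for j
  have e_sum: "(\<Sum>j<K. e j) = (real K - 1) + \<alpha>"
  proof -
    obtain K' where K': "K = Suc K'" using K by (cases K) auto
    have "(\<Sum>j<K'. e j) = (\<Sum>j<K'. 1)" by (intro sum.cong) (auto simp: e_def K')
    then show ?thesis by (simp add: K' e_def)
  qed
  have "\<exists>c>0. \<forall>r. 0 < r \<and> r \<le> 1 \<longrightarrow> c * r powr e j \<le> measure ?B {x. \<bar>x - ?u j\<bar> \<le> r}" if j: "j < K" for j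
  proof (cases "Suc j < K")
    case True
    then show ?thesis using beta_measure_near[OF \<alpha> st(2)[OF True]] by (simp add: e_def)
  next
    case False
    then have "?u j = 1" using st(3)[of j] j by auto
    then show ?thesis using beta_measure_near_one[OF \<alpha>] False by (simp add: e_def)
  qed
  from prod_powr_lower[of K e "\<lambda>j r. measure ?B {x. \<bar>x - ?u j\<bar> \<le> r}", OF this] obtain c1 where c1: "0 < c1"
    "\<And>r. 0 < r \<Longrightarrow> r \<le> 1 \<Longrightarrow> c1 * r powr ((real K - 1) + \<alpha>) \<le> (\<Prod>j<K. measure ?B {x. \<bar>x - ?u j\<bar> \<le> r})"
    unfolding e_sum by blast
  have "\<exists>c>0. \<forall>r. 0 < r \<and> r \<le> 1 \<longrightarrow> c * r powr real DIM('a) \<le> measure P0 (ball (\<theta>s j) r)" if j: "j < K" for j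
    using density_ball_mass[OF P0(1)[unfolded P0(2)] \<Theta>(1) \<Theta>(2)[OF j] p0(1,2) p0(3)[OF j] fat[OF j]]
    by (simp add: P0(2) powr_realpow cong: conj_cong)
  from prod_powr_lower[of K "\<lambda>_. real DIM('a)" "\<lambda>j r. measure P0 (ball (\<theta>s j) r)", OF this] obtain c2 where c2: "0 < c2"
    "\<And>r. 0 < r \<Longrightarrow> r \<le> 1 \<Longrightarrow> c2 * r powr (real K * DIM('a)) \<le> (\<Prod>j<K. measure P0 (ball (\<theta>s j) r))"
    by auto
  have AE1: "AE v in PiM UNIV (\<lambda>_::nat. ?B). (\<forall>j. v j \<in> {0<..<1}) \<and> stick_weight v sums 1"
    unfolding AE_conj_iff AE_all_countable
    by (intro conjI allI AE_PiM_component[where P = "\<lambda>x. x \<in> {0<..<1}"] AE_beta_measure B.prob_space_axioms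
        AE_stick_weights_sum \<alpha>) auto
  have \<Theta>s[measurable]: "\<Theta> \<in> sets borel" using \<Theta>(1) by (simp add: borel_compact)
  have meas[measurable]: "(\<lambda>x. p0 x * indicator \<Theta> x) \<in> borel_measurable borel"
    using borel_measurable_continuous_on_indicator[OF \<Theta>s p0(1)] by (simp add: mult.commute)
  have "AE x in P0. x \<in> \<Theta>"
  proof -
    have "(\<lambda>x. ennreal (p0 x * indicator \<Theta> x)) \<in> borel_measurable lborel"
      using meas by (intro measurable_compose[OF _ measurable_ennreal]) simp
    then show ?thesis
      unfolding P0(2) by (subst AE_density) (auto intro!: AE_I2 simp: indicator_def)
  qed
  then have AE2: "AE \<theta> in PiM UNIV (\<lambda>_::nat. P0). \<forall>k. \<theta> k \<in> \<Theta>"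
    unfolding AE_all_countable
    by (intro allI AE_PiM_component[where P = "\<lambda>x. x \<in> \<Theta>"] P0.prob_space_axioms) auto
  have "\<exists>A\<in>sets M.
      c1 * c2 * r powr (real K * DIM('a) + (real K - 1) + \<alpha>) \<le> measure M A \<and>
      A \<subseteq> near_sticks \<Theta> K ws \<theta>s r" if r: "0 < r" "r \<le> 1" for r
  proof -
    obtain C1 where C1: "C1 \<in> sets (PiM UNIV (\<lambda>_::nat. ?B))"
      "\<And>v. v \<in> C1 \<Longrightarrow> (\<forall>j. v j \<in> {0<..<1}) \<and> stick_weight v sums 1"
      "\<And>v j. v \<in> C1 \<Longrightarrow> j < K \<Longrightarrow> \<bar>v j - ?u j\<bar> \<le> r"
      "measure (PiM UNIV (\<lambda>_::nat. ?B)) C1 = (\<Prod>j<K. measure ?B {x. \<bar>x - ?u j\<bar> \<le> r})"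
      using cylinder_inter_AE[OF B.prob_space_axioms _ AE1, of K "\<lambda>j. {x. \<bar>x - ?u j\<bar> \<le> r}"] by auto
    obtain C2 where C2: "C2 \<in> sets (PiM UNIV (\<lambda>_::nat. P0))"
      "\<And>v k. v \<in> C2 \<Longrightarrow> v k \<in> \<Theta>"
      "\<And>v j. v \<in> C2 \<Longrightarrow> j < K \<Longrightarrow> v j \<in> ball (\<theta>s j) r"
      "measure (PiM UNIV (\<lambda>_::nat. P0)) C2 = (\<Prod>j<K. measure P0 (ball (\<theta>s j) r))"
      using cylinder_inter_AE[OF P0.prob_space_axioms _ AE2, of K "\<lambda>j. ball (\<theta>s j) r"] by (auto simp: P0(2))
    have M_eq: "measure M (C1 \<times> C2) = measure (PiM UNIV (\<lambda>_::nat. ?B)) C1 * measure (PiM UNIV (\<lambda>_::nat. P0)) C2"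
      unfolding M_def using C1(1) C2(1) by (simp add: measure_def PP.emeasure_pair_measure_Times enn2real_mult)
    have c_eq: "c1 * c2 * r powr (real K * DIM('a) + (real K - 1) + \<alpha>)
        = (c1 * r powr ((real K - 1) + \<alpha>)) * (c2 * r powr (real K * DIM('a)))"
    proof -
      have "real K * DIM('a) + (real K - 1) + \<alpha> = ((real K - 1) + \<alpha>) + real K * DIM('a)" by simp
      then show ?thesis by (simp only: powr_add mult_ac)
    qed
    have mass: "c1 * c2 * r powr (real K * DIM('a) + (real K - 1) + \<alpha>) \<le> measure M (C1 \<times> C2)"
      unfolding M_eq c_eq C1(4) C2(4) using c1(2)[OF r] c2(2)[OF r]
      by (rule mult_mono) (simp_all add: prod_nonneg less_imp_le[OF c2(1)])
    have near: "\<bar>stick_weight v k - ws k\<bar> \<le> real K * r" if v: "v \<in> C1" and k: "k < K" for v k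
    proof -
      have "\<bar>stick_weight v k - stick_weight ?u k\<bar> \<le> real (Suc k) * r"
      proof (rule stick_weight_diff_le)
        fix j assume "j \<le> k"
        then have j: "j < K" using k by simp
        have "?u j \<in> {0..1}" using st(2,3)[of j] j by (cases "Suc j < K") (auto dest: Suc_lessI)
        then show "v j \<in> {0..1} \<and> ?u j \<in> {0..1} \<and> \<bar>v j - ?u j\<bar> \<le> r"
          using C1(2,3)[OF v] j by (auto simp: less_imp_le)
      qed
      also have "\<dots> \<le> real K * r" using k r by (intro mult_right_mono) auto
      finally show ?thesis using st(1)[OF k] by simp
    qed
    have tail: "1 - (\<Sum>k<K. stick_weight v k) \<le> r" if v: "v \<in> C1" for v
    proof -
      obtain K' where K': "K = Suc K'" using K by (cases K) auto
      have v01: "0 < v j" "v j < 1" for j using C1(2)[OF v] by auto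
      have "\<bar>v K' - 1\<bar> \<le> r" using C1(3)[OF v, of K'] st(3)[of K'] K' by simp
      then have "(\<Prod>j<K'. 1 - v j) * (1 - v K') \<le> 1 * r"
        using v01 by (intro mult_mono prod_le_1) (auto simp: less_imp_le)
      then show ?thesis unfolding sum_stick_weight K' by simp
    qed
    show ?thesis
    proof (rule bexI[of _ "C1 \<times> C2"], rule conjI[OF mass])
      show "C1 \<times> C2 \<in> sets M" unfolding M_def using C1(1) C2(1) by (rule pair_measureI)
      show "C1 \<times> C2 \<subseteq> near_sticks \<Theta> K ws \<theta>s r"
      proof
        fix w assume "w \<in> C1 \<times> C2"
        then obtain v \<theta> where w: "w = (v, \<theta>)" "v \<in> C1" "\<theta> \<in> C2" by auto
        have "norm (\<theta> k - \<theta>s k) \<le> r" if "k < K" for k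
          using C2(3)[OF w(3) that] by (simp add: dist_norm norm_minus_commute)
        then show "w \<in> near_sticks \<Theta> K ws \<theta>s r"
          unfolding near_sticks_def w(1) using C1(2)[OF w(2)] C2(2)[OF w(3)] near[OF w(2)] tail[OF w(2)] by blast
      qed
    qed
  qed
  moreover have "0 < c1 * c2" using c1 c2 by simp
  ultimately show ?thesis by blast
qed

section \<open>Mixture densities of discrete and of random mixing measures\<close>

lemma mixture_density_discrete_finite:
  assumes f[measurable]: "f \<in> borel_measurable borel" and "finite I" "\<And>i. i \<in> I \<Longrightarrow> 0 \<le> w i"
  shows "mixture_density f (discrete_measure I w \<theta>) x = (\<Sum>i\<in>I. w i * f (x - \<theta> i))"
proof -
  have "mixture_density f (discrete_measure I w \<theta>) x = (\<integral>i. f (x - \<theta> i) \<partial>density (count_space I) (\<lambda>i. ennreal (w i)))"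
    unfolding mixture_density_def discrete_measure_def by (subst integral_distr) auto
  also have "\<dots> = (\<integral>i. w i * f (x - \<theta> i) \<partial>count_space I)"
    using assms by (subst integral_density) (auto simp: AE_count_space)
  also have "\<dots> = (\<Sum>i\<in>I. w i * f (x - \<theta> i))"
    using assms by (simp add: lebesgue_integral_count_space_finite)
  finally show ?thesis .
qed

lemma mixture_density_stick_breaking:
  assumes f[measurable]: "f \<in> borel_measurable borel" and fb: "\<And>y. \<bar>f y\<bar> \<le> F"
    and v: "\<And>j. v j \<in> {0<..<1}" and s: "stick_weight v sums 1"
  shows "mixture_density f (stick_breaking v \<theta>) x = (\<Sum>k. stick_weight v k * f (x - \<theta> k))"
proof -
  let ?w = "stick_weight v"
  have w: "0 \<le> ?w k" for k using v by (rule stick_weight_nonneg)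
  have "prob_space (discrete_measure UNIV ?w \<theta>)"
  proof
    have "(\<Sum>k. ennreal (?w k)) = ennreal 1"
      using s w by (intro suminf_ennreal_eq) auto
    then show "emeasure (discrete_measure UNIV ?w \<theta>) (space (discrete_measure UNIV ?w \<theta>)) = 1"
      by (simp add: emeasure_discrete_measure_nat)
  qed
  then have "mixture_density f (stick_breaking v \<theta>) x = (\<integral>i. f (x - \<theta> i) \<partial>density (count_space UNIV) (\<lambda>i. ennreal (?w i)))"
    unfolding mixture_density_def by (simp add: stick_breaking_def discrete_measure_def integral_distr)
  also have "\<dots> = (\<integral>i. ?w i * f (x - \<theta> i) \<partial>count_space UNIV)"
    using w by (subst integral_density) auto
  also have "\<dots> = (\<Sum>k. ?w k * f (x - \<theta> k))"
  proof (rule integral_count_space_nat)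
    have "summable (\<lambda>k. norm (?w k * f (x - \<theta> k)))"
    proof (rule summable_comparison_test'[of "\<lambda>k. ?w k * F" 0])
      show "summable (\<lambda>k. ?w k * F)" using s by (intro summable_mult2) (auto simp: sums_iff)
      show "norm (norm (?w k * f (x - \<theta> k))) \<le> ?w k * F" for k
        using w fb by (simp add: abs_mult mult_left_mono)
    qed
    then show "integrable (count_space UNIV) (\<lambda>i. ?w i * f (x - \<theta> i))"
      by (simp add: integrable_count_space_nat_iff)
  qed
  finally show ?thesis .
qed

lemma mixture_density_of_prob_space:
  fixes f :: "'a::euclidean_space \<Rightarrow> real"
  assumes f[measurable]: "f \<in> borel_measurable borel" and f0: "\<And>y. 0 \<le> f y" and fb: "\<And>y. f y \<le> F"
    and f1: "prob_space (density lborel (\<lambda>x. ennreal (f x)))"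
    and P: "prob_space P" "sets P = sets borel"
  shows "0 \<le> mixture_density f P x" and "mixture_density f P x \<le> F"
    and "(\<integral>\<^sup>+x. ennreal (mixture_density f P x) \<partial>lborel) = 1"
proof -
  interpret P: prob_space P by fact
  interpret PL: pair_sigma_finite P lborel by unfold_locales
  note [measurable_cong] = P(2)
  have int: "integrable P (\<lambda>\<theta>. f (x - \<theta>))" for x
    using f0 fb by (intro P.integrable_const_bound[where B = F]) auto
  have eq: "ennreal (mixture_density f P x) = (\<integral>\<^sup>+\<theta>. ennreal (f (x - \<theta>)) \<partial>P)" for x
    unfolding mixture_density_def using f0 int by (intro nn_integral_eq_integral[symmetric]) auto
  show "0 \<le> mixture_density f P x" unfolding mixture_density_def using f0 by (intro integral_nonneg_AE) auto
  have "mixture_density f P x \<le> (\<integral>\<theta>. F \<partial>P)"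
    unfolding mixture_density_def using int fb by (intro integral_mono) auto
  then show "mixture_density f P x \<le> F" by (simp add: P.prob_space)
  have shift: "(\<integral>\<^sup>+x. ennreal (f (x - \<theta>)) \<partial>lborel) = 1" for \<theta>
  proof -
    have "(\<integral>\<^sup>+x. ennreal (f x) \<partial>distr lborel borel ((+) (- \<theta>))) = (\<integral>\<^sup>+x. ennreal (f (x - \<theta>)) \<partial>lborel)"
      by (subst nn_integral_distr) auto
    moreover have "(\<integral>\<^sup>+x. ennreal (f x) \<partial>lborel) = 1"
      using prob_space.emeasure_space_1[OF f1] by (simp add: emeasure_density)
    ultimately show ?thesis by (simp add: lborel_distr_plus)
  qed
  have "(\<integral>\<^sup>+x. ennreal (mixture_density f P x) \<partial>lborel) = (\<integral>\<^sup>+x. (\<integral>\<^sup>+\<theta>. ennreal (f (x - \<theta>)) \<partial>P) \<partial>lborel)"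
    by (simp add: eq)
  also have "\<dots> = (\<integral>\<^sup>+\<theta>. (\<integral>\<^sup>+x. ennreal (f (x - \<theta>)) \<partial>lborel) \<partial>P)"
    by (rule PL.Fubini') measurable
  finally show "(\<integral>\<^sup>+x. ennreal (mixture_density f P x) \<partial>lborel) = 1"
    by (simp add: shift P.emeasure_space_1)
qed

text \<open>
  Joint measurability in the parameter and the point is what Fubini's theorem needs. Writing the mixture
  density as a nonnegative integral makes it a consequence of the measurability of integrals against kernels.
\<close>

lemma measurable_mixture_density_kernel:
  fixes f :: "'a::euclidean_space \<Rightarrow> real"
  assumes f[measurable]: "f \<in> borel_measurable borel" and f0: "\<And>y. 0 \<le> f y"
    and L[measurable]: "L \<in> M \<rightarrow>\<^sub>M prob_algebra borel"
  shows "(\<lambda>(w, x). mixture_density f (L w) x) \<in> borel_measurable (M \<Otimes>\<^sub>M borel)"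
proof -
  have [measurable]: "L \<in> M \<rightarrow>\<^sub>M subprob_algebra borel"
    using L by (rule measurable_prob_algebraD)
  have "(\<lambda>z. \<integral>\<^sup>+\<theta>. ennreal (f (snd z - \<theta>)) \<partial>L (fst z)) \<in> borel_measurable (M \<Otimes>\<^sub>M borel)"
    by (rule nn_integral_measurable_subprob_algebra2[where N = borel]) measurable
  then have meas: "(\<lambda>z. enn2real (\<integral>\<^sup>+\<theta>. ennreal (f (snd z - \<theta>)) \<partial>L (fst z))) \<in> borel_measurable (M \<Otimes>\<^sub>M borel)"
    by measurable
  have eq: "mixture_density f (L (fst z)) (snd z) = enn2real (\<integral>\<^sup>+\<theta>. ennreal (f (snd z - \<theta>)) \<partial>L (fst z))"
    if z: "z \<in> space (M \<Otimes>\<^sub>M borel)" for z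
  proof -
    have "fst z \<in> space M" using z by (auto simp: space_pair_measure)
    then have sets_L: "sets (L (fst z)) = sets borel"
      using measurable_space[OF L] by (auto simp: space_prob_algebra)
    have "(\<lambda>\<theta>. f (snd z - \<theta>)) \<in> borel_measurable (L (fst z))"
      unfolding measurable_cong_sets[OF sets_L refl] by (rule measurable_compose[OF _ f]) simp
    then show ?thesis
      unfolding mixture_density_def using f0 by (intro integral_eq_nn_integral AE_I2)
  qed
  have "(\<lambda>z. mixture_density f (L (fst z)) (snd z)) \<in> borel_measurable (M \<Otimes>\<^sub>M borel)"
    by (rule measurable_cong[THEN iffD2, OF eq meas])
  then show ?thesis by (simp only: case_prod_unfold)
qed

section \<open>Lower bound for the evidence of the Dirichlet process mixture\<close>

theorem theorem1:
  fixes f p0 :: "'a::euclidean_space \<Rightarrow> real"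
    and \<alpha> :: real and P0 Pstar Q :: "'a measure" and \<Theta> :: "'a set"
    and K :: nat and wstar :: "nat \<Rightarrow> real" and \<theta>star :: "nat \<Rightarrow> 'a"
  assumes f_density: "prob_space (density lborel (\<lambda>x. ennreal (f x)))"
    and alpha: "\<alpha> > 0"
    and weights: "\<forall>k<K. wstar k > 0" "(\<Sum>k<K. wstar k) = 1"
    and atoms: "inj_on \<theta>star {..<K}"
    and Pstar: "Pstar = discrete_measure {..<K} wstar \<theta>star"
    and Q: "Q = density lborel (\<lambda>x. ennreal (mixture_density f Pstar x))"
    and Theta: "compact \<Theta>" "\<forall>k<K. \<theta>star k \<in> \<Theta>"
    and P0: "prob_space P0" "P0 = density lborel (\<lambda>x. ennreal (p0 x * indicator \<Theta> x))"
    and p0: "\<forall>x\<in>\<Theta>. p0 x \<ge> 0" "continuous_on \<Theta> p0" "bounded (p0 ` \<Theta>)"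
    and p0_pos: "\<forall>k<K. p0 (\<theta>star k) > 0"
    and fat: "\<forall>k<K. fat_at \<Theta> (\<theta>star k)"
    and f_C3: "C3 f"
    and f_bounds: "\<exists>F. \<forall>x. 0 < f x \<and> f x < F"
    and f_log: "\<exists>R \<gamma>. R > 0 \<and> \<gamma> \<ge> 0
      \<and> (\<forall>x. norm (grad (\<lambda>y. ln (f y)) x) \<le> R * (1 + norm x) powr \<gamma>)
      \<and> (\<forall>x. norm (grad (grad (\<lambda>y. ln (f y))) x) \<le> R * (1 + norm x) powr \<gamma>)
      \<and> (\<forall>M>0. integrable lborel (\<lambda>x. exp (M * norm x powr \<gamma>) * f x))"
    and f_decay: "\<exists>C r. C > 0 \<and> r > 0
      \<and> (\<forall>x. norm (grad f x) \<le> C * (1 + norm x) powr - (real DIM('a) + r)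
           \<and> norm (grad (grad f) x) \<le> C * (1 + norm x) powr - (real DIM('a) + r)
           \<and> norm (grad (grad (grad f)) x) \<le> C * (1 + norm x) powr - (real DIM('a) + r))"
  shows "\<forall>\<epsilon>>0. \<exists>c>0. \<forall>n\<ge>1.
    measure (PiM {..<n} (\<lambda>_. Q))
      {X \<in> space (PiM {..<n} (\<lambda>_. Q)).
        (\<integral>P. (\<Prod>i<n. mixture_density f P (X i) / mixture_density f Pstar (X i))
           \<partial>dirichlet_process \<alpha> P0)
        \<ge> c * real n powr (- (real DIM('a) * real K / 2) - (real K - 1) / 2 - \<alpha> / 2)}
    \<ge> 1 - \<epsilon>"
proof -
  obtain F where f_pos: "\<And>x. 0 < f x" and f_lt: "\<And>x. f x < F"
    using f_bounds by blast
  obtain R \<gamma> where R: "0 < R" "0 \<le> \<gamma>"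
    and log_grad: "\<And>x. norm (grad (\<lambda>y. ln (f y)) x) \<le> R * (1 + norm x) powr \<gamma>"
    and exp_int: "\<And>M. 0 < M \<Longrightarrow> integrable lborel (\<lambda>x. exp (M * norm x powr \<gamma>) * f x)"
    using f_log by blast
  have f_diff: "f differentiable (at x)" for x
    using f_C3 by (auto simp: C3_def differentiable_on_def)
  have f_cont: "continuous_on UNIV f"
    using f_C3 by (auto simp: C3_def intro: differentiable_imp_continuous_on)
  have f_meas[measurable]: "f \<in> borel_measurable borel"
    using f_cont by (rule borel_measurable_continuous_onI)
  have f_nonneg: "0 \<le> f x" and f_le: "f x \<le> F" and f_abs: "\<bar>f x\<bar> \<le> F" for x
    using f_pos[of x] f_lt[of x] by auto
  note props = mixture_density_of_prob_space[OF f_meas f_nonneg f_le f_density]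
  obtain L where L: "\<And>a. a \<in> \<Theta> \<Longrightarrow> norm a \<le> L"
    using Theta(1) by (meson bounded_iff compact_imp_bounded)
  have K: "0 < K" using weights(2) by (cases K) auto
  have "\<theta>star 0 \<in> \<Theta>" using Theta(2) K by blast
  from order.trans[OF norm_ge_zero L[OF this]] have L0: "0 \<le> L" .

  define q where "q = mixture_density f Pstar"
  have q_sum: "q x = (\<Sum>k<K. wstar k * f (x - \<theta>star k))" for x
    unfolding q_def Pstar using weights(1) by (intro mixture_density_discrete_finite) (auto simp: less_imp_le)
  have q_meas[measurable]: "q \<in> borel_measurable borel"
    unfolding q_sum[abs_def] by measurable
  have q_pos: "0 < q x" for x
    unfolding q_sum using weights(1) f_pos K by (intro sum_pos) auto
  have q_ne: "q x \<noteq> 0" for x using q_pos[of x] by simp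
  have "prob_space Pstar"
  proof
    have "(\<Sum>k<K. ennreal (wstar k)) = 1"
      using weights by (subst sum_ennreal) (auto simp: less_imp_le)
    then show "emeasure Pstar (space Pstar) = 1"
      by (simp add: Pstar emeasure_discrete_measure_finite)
  qed
  then have q1: "(\<integral>\<^sup>+x. ennreal (q x) \<partial>lborel) = 1"
    unfolding q_def by (intro props(3)) (simp_all add: Pstar)
  have Q_eq: "Q = density lborel (\<lambda>x. ennreal (q x))" by (simp add: Q q_def)
  have Q_prob: "prob_space Q"
    unfolding Q_eq using q1 by (intro prob_spaceI) (simp add: emeasure_density)
  have Q_sets[measurable_cong]: "sets Q = sets borel" and Q_space: "space Q = UNIV" by (simp_all add: Q_eq)

  define M where "M = PiM UNIV (\<lambda>_::nat. beta_measure 1 \<alpha>) \<Otimes>\<^sub>M PiM UNIV (\<lambda>_::nat. P0)"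
  define S :: "(nat \<Rightarrow> real) \<times> (nat \<Rightarrow> 'a) \<Rightarrow> 'a measure" where "S = (\<lambda>(v, \<theta>). stick_breaking v \<theta>)"
  have P0_sets: "sets P0 = sets borel" by (simp add: P0(2))
  have S_meas[measurable]: "S \<in> M \<rightarrow>\<^sub>M prob_algebra borel"
    unfolding S_def M_def by (rule measurable_stick_breaking[OF P0_sets])
  have M_prob: "prob_space M"
  proof -
    interpret B: prob_space "beta_measure 1 \<alpha>" using alpha by (intro prob_space_beta_measure) auto
    interpret P0: prob_space P0 by (rule P0(1))
    interpret PB: product_prob_space "\<lambda>_::nat. beta_measure 1 \<alpha>" UNIV by unfold_locales
    interpret PP: product_prob_space "\<lambda>_::nat. P0" UNIV by unfold_locales
    interpret BP: pair_prob_space "PiM UNIV (\<lambda>_::nat. beta_measure 1 \<alpha>)" "PiM UNIV (\<lambda>_::nat. P0)"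
      by unfold_locales
    show ?thesis unfolding M_def by unfold_locales
  qed
  interpret M: prob_space M by (rule M_prob)
  have S_prob: "prob_space (S w)" "sets (S w) = sets borel" if "w \<in> space M" for w
    using measurable_space[OF S_meas that] by (auto simp: space_prob_algebra)
  define h where "h w x = mixture_density f (S w) x / q x" for w x
  have h_meas: "(\<lambda>(w, x). h w x) \<in> borel_measurable (M \<Otimes>\<^sub>M Q)"
    unfolding h_def using measurable_mixture_density_kernel[OF f_meas f_nonneg S_meas]
    unfolding measurable_cong_sets[OF sets_pair_measure_cong[OF refl Q_sets] refl] case_prod_unfold
    by (intro borel_measurable_divide measurable_compose[OF measurable_snd q_meas])
  have h_nonneg: "0 \<le> h w x" if "w \<in> space M" for w x
    using props(1)[OF S_prob[OF that]] q_pos[of x] by (simp add: h_def)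
  have h_le: "h w x \<le> F / q x" if "w \<in> space M" for w x
    using props(2)[OF S_prob[OF that]] q_pos[of x] by (simp add: h_def divide_right_mono)
  \<comment> \<open>A Bochner integral that diverges is \<open>0\<close>, so a lower bound for the integral requires integrability.\<close>
  have h_int: "integrable M (\<lambda>w. \<Prod>i<n. h w (X i))" for X :: "nat \<Rightarrow> 'a" and n
  proof (rule M.integrable_const_bound[where B = "\<Prod>i<n. F / q (X i)"])
    have "(\<lambda>w. h w x) \<in> borel_measurable M" for x
      using measurable_Pair1[OF h_meas, of x] by (simp add: Q_space)
    then show "(\<lambda>w. \<Prod>i<n. h w (X i)) \<in> borel_measurable M" by measurable
    show "AE w in M. norm (\<Prod>i<n. h w (X i)) \<le> (\<Prod>i<n. F / q (X i))"
      using h_nonneg h_le by (intro AE_I2) (auto simp: abs_prod intro!: prod_mono)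
  qed
  have h_mean: "(\<integral>x. h w x \<partial>Q) = 1" if w: "w \<in> space M" for w
  proof -
    have [measurable]: "mixture_density f (S w) \<in> borel_measurable borel"
      using measurable_Pair2[OF measurable_mixture_density_kernel[OF f_meas f_nonneg S_meas] w] by simp
    have "(\<integral>x. h w x \<partial>Q) = (\<integral>x. mixture_density f (S w) x \<partial>lborel)"
      unfolding Q_eq h_def using q_pos
      by (subst integral_density) (auto simp: less_imp_le q_ne)
    also have "\<dots> = enn2real (\<integral>\<^sup>+x. ennreal (mixture_density f (S w) x) \<partial>lborel)"
      using props(1)[OF S_prob[OF w]] by (intro integral_eq_nn_integral) auto
    finally show ?thesis by (simp add: props(3)[OF S_prob[OF w]])
  qed
  have DP: "(\<integral>P. (\<Prod>i<n. mixture_density f P (X i) / mixture_density f Pstar (X i)) \<partial>dirichlet_process \<alpha> P0)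
      = (\<integral>w. (\<Prod>i<n. h w (X i)) \<partial>M)" for X :: "nat \<Rightarrow> 'a" and n
  proof -
    have "(\<lambda>P. mixture_density f P x) \<in> borel_measurable (prob_algebra borel)" for x
      unfolding mixture_density_def prob_algebra_def
      by (intro measurable_restrict_space1 integral_measurable_subprob_algebra) measurable
    then have m: "(\<lambda>P. \<Prod>i<n. mixture_density f P (X i) / mixture_density f Pstar (X i))
        \<in> borel_measurable (prob_algebra borel)"
      by (intro borel_measurable_prod borel_measurable_divide borel_measurable_const)
    show ?thesis
      unfolding dirichlet_process_def
      by (subst integral_distr[OF S_meas[unfolded S_def M_def] m]) (simp only: M_def S_def h_def q_def case_prod_unfold)
  qed

  \<comment> \<open>\<open>b x\<close> is the Lipschitz constant of \<open>ln f\<close> around \<open>x\<close>. In \<open>G\<close>, weights may be off by \<open>K * r\<close> (the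
    constant \<open>C\<close> of \<open>mixture_sum_ratio\<close> is \<open>K\<close>) and the diameter of \<open>\<Theta>\<close> is at most \<open>2 * L\<close>.\<close>
  define b where "b x = R * (1 + L + norm x) powr \<gamma>" for x :: 'a
  define G where "G x = (K * real K + 2) * exp (b x * (2 * L + 2))" for x :: 'a
  have b0: "0 \<le> b x" for x using R by (simp add: b_def)
  have G_meas[measurable]: "G \<in> borel_measurable borel" unfolding G_def b_def by measurable
  have G1: "1 \<le> G x" for x
  proof -
    have "1 * 1 \<le> G x" unfolding G_def using b0[of x] L0 by (intro mult_mono) auto
    then show ?thesis by simp
  qed
  have G_int: "integrable Q (\<lambda>x. G x ^ 3)"
  proof -
    define m where "m = 3 * ((2 * L + 2) * R)"
    have m: "0 < m" using L0 R by (simp add: m_def)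
    have G3: "G x ^ 3 = (K * real K + 2) ^ 3 * exp (m * (1 + L + norm x) powr \<gamma>)" for x
      unfolding G_def b_def m_def power_mult_distrib exp_of_nat_mult[symmetric] by (simp add: mult_ac)
    have "integrable lborel (\<lambda>x. (K * real K + 2) ^ 3 * (\<Sum>k<K. wstar k * (exp (m * (1 + L + norm x) powr \<gamma>) * f (x - \<theta>star k))))"
      using L Theta(2) R m
      by (intro integrable_mult_right Bochner_Integration.integrable_sum integrable_exp_envelope_shift f_meas f_nonneg exp_int) auto
    also have "(\<lambda>x. (K * real K + 2) ^ 3 * (\<Sum>k<K. wstar k * (exp (m * (1 + L + norm x) powr \<gamma>) * f (x - \<theta>star k))))
        = (\<lambda>x. q x *\<^sub>R (G x ^ 3))"
      by (rule ext) (simp only: G3 q_sum real_scaleR_def sum_distrib_left sum_distrib_right mult_ac)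
    finally show ?thesis
      unfolding Q_eq using q_pos by (subst integrable_density) (auto simp: less_imp_le)
  qed

  obtain c0 where c0: "0 < c0" and mass: "\<And>r. 0 < r \<Longrightarrow> r \<le> 1 \<Longrightarrow> (\<exists>A\<in>sets M.
      c0 * r powr (real K * DIM('a) + (real K - 1) + \<alpha>) \<le> measure M A \<and>
      A \<subseteq> near_sticks \<Theta> K wstar \<theta>star r)"
  proof -
    have "\<exists>c>0. \<forall>r. 0 < r \<and> r \<le> 1 \<longrightarrow> (\<exists>A\<in>sets M.
        c * r powr (real K * DIM('a) + (real K - 1) + \<alpha>) \<le> measure M A \<and> A \<subseteq> near_sticks \<Theta> K wstar \<theta>star r)"
      unfolding M_def
      by (rule prior_mass_near_mixing_measure[OF alpha _ weights(2) P0 Theta(1) _ p0(2)])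
         (use weights(1) Theta(2) p0(1) p0_pos fat in blast)+
    then show ?thesis using that by blast
  qed

  show ?thesis
  proof (intro allI impI)
    fix \<epsilon> :: real assume \<epsilon>: "0 < \<epsilon>"
    \<comment> \<open>Chosen such that the failure probability of \<open>evidence_lower_bound\<close> equals \<open>\<epsilon>\<close>.\<close>
    define t where "t = (1 + 2 * (\<integral>x. G x ^ 3 \<partial>Q)) / \<epsilon>"
    have I0: "0 \<le> (\<integral>x. G x ^ 3 \<partial>Q)"
      by (intro G1 integral_nonneg_AE AE_I2 zero_le_power order.trans[OF zero_le_one])
    have t: "0 < t" using I0 \<epsilon> by (simp add: t_def)
    show "\<exists>c>0. \<forall>n\<ge>1. 1 - \<epsilon> \<le> measure (PiM {..<n} (\<lambda>_. Q))
      {X \<in> space (PiM {..<n} (\<lambda>_. Q)). c * real n powr (- (real DIM('a) * real K / 2) - (real K - 1) / 2 - \<alpha> / 2)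
        \<le> (\<integral>P. (\<Prod>i<n. mixture_density f P (X i) / mixture_density f Pstar (X i)) \<partial>dirichlet_process \<alpha> P0)}"
    proof (intro exI[of _ "exp (- t) * c0"] conjI allI impI)
      show "0 < exp (- t) * c0" using c0 by simp
      fix n :: nat assume n: "1 \<le> n"
      define r where "r = 1 / sqrt n"
      have r: "0 < r" "r \<le> 1" using n by (auto simp: r_def)
      define a where "a = c0 * r powr (real K * DIM('a) + (real K - 1) + \<alpha>)"
      have a0: "0 < a" using c0 r by (simp add: a_def)
      have a_eq: "exp (- t) * c0 * real n powr (- (real DIM('a) * real K / 2) - (real K - 1) / 2 - \<alpha> / 2) = exp (- t) * a"
      proof -
        have r_eq: "r = real n powr (- 1 / 2)"
          unfolding r_def powr_half_sqrt[OF of_nat_0_le_iff, symmetric] by (simp add: powr_minus_divide)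
        have "r powr (real K * DIM('a) + (real K - 1) + \<alpha>)
            = real n powr (- (real DIM('a) * real K / 2) - (real K - 1) / 2 - \<alpha> / 2)"
          unfolding r_eq powr_powr by (rule arg_cong[where f = "(powr) (real n)"]) (simp add: field_simps)
        then show ?thesis by (simp add: a_def)
      qed
      obtain A where A: "A \<in> sets M" "a \<le> measure M A" and A_near: "A \<subseteq> near_sticks \<Theta> K wstar \<theta>star r"
        using mass[OF r] unfolding a_def by blast
      have bounds: "\<bar>h w x - 1\<bar> \<le> G x * r" "1 / G x \<le> h w x" if w: "w \<in> A" for w x
      proof -
        obtain v \<theta> where vt: "w = (v, \<theta>)" by (cases w)
        have "(v, \<theta>) \<in> near_sticks \<Theta> K wstar \<theta>star r" using w A_near vt by blast
        then have g: "\<And>j. v j \<in> {0<..<1}" "stick_weight v sums 1" "\<And>k. \<theta> k \<in> \<Theta>"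
            "\<And>k. k < K \<Longrightarrow> \<bar>stick_weight v k - wstar k\<bar> \<le> real K * r"
            "\<And>k. k < K \<Longrightarrow> norm (\<theta> k - \<theta>star k) \<le> r" "1 - (\<Sum>k<K. stick_weight v k) \<le> r"
          by (auto simp: near_sticks_def)
        have h_eq: "h w x = (\<Sum>k. stick_weight v k * f (x - \<theta> k)) / (\<Sum>k<K. wstar k * f (x - \<theta>star k))"
          unfolding h_def vt S_def q_sum prod.case
          by (subst mixture_density_stick_breaking[OF f_meas f_abs g(1,2)]) (rule refl)
        have diam: "norm (a - a') \<le> 2 * L" if "a \<in> \<Theta>" "a' \<in> \<Theta>" for a a'
          using L[OF that(1)] L[OF that(2)] norm_triangle_ineq4[of a a'] by simp
        have lip: "\<bar>ln (f (x - a)) - ln (f (x - a'))\<bar> \<le> b x * norm (a - a')" if "a \<in> \<Theta>" "a' \<in> \<Theta>" for a a'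
          unfolding b_def
          by (rule ln_shift_Lipschitz[OF f_diff f_pos log_grad less_imp_le[OF R(1)] R(2) L[OF that(1)] L[OF that(2)]])
        have ws: "k < K \<Longrightarrow> 0 \<le> wstar k" "k < K \<Longrightarrow> \<theta>star k \<in> \<Theta>" for k
          using weights(1) Theta(2) by (auto simp: less_imp_le)
        note ratio = mixture_sum_ratio[of \<Theta> "\<lambda>a. f (x - a)" "b x" "2 * L" "real K" r K wstar \<theta>star "stick_weight v" \<theta>,
            OF f_pos lip diam b0 of_nat_0_le_iff r ws(1) weights(2) ws(2) stick_weight_nonneg[OF g(1)] g(2-6)]
        show "\<bar>h w x - 1\<bar> \<le> G x * r" "1 / G x \<le> h w x"
          unfolding h_eq G_def using ratio by simp_all
      qed
      have "1 - (1 + 2 * (\<integral>x. G x ^ 3 \<partial>Q)) / t \<le> measure (PiM {..<n} (\<lambda>_. Q))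
          {X \<in> space (PiM {..<n} (\<lambda>_. Q)). exp (- t) * a \<le> (\<integral>w. (\<Prod>i<n. h w (X i)) \<partial>M)}"
      proof (rule evidence_lower_bound[OF M_prob Q_prob h_meas h_nonneg h_int A(1) a0 A(2) _ G1 G_int _ bounds(2) h_mean n t])
        show "\<bar>h w x - 1\<bar> \<le> G x / sqrt n" if "w \<in> A" for w x
          using bounds(1)[OF that, of x] by (simp add: r_def)
        show "w \<in> space M" if "w \<in> A" for w
          using that A(1) sets.sets_into_space by blast
      qed (auto simp: measurable_cong_sets[OF Q_sets refl])
      also have "1 - (1 + 2 * (\<integral>x. G x ^ 3 \<partial>Q)) / t = 1 - \<epsilon>"
        using I0 \<epsilon> by (simp add: t_def)
      finally show "1 - \<epsilon> \<le> measure (PiM {..<n} (\<lambda>_. Q))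
        {X \<in> space (PiM {..<n} (\<lambda>_. Q)). exp (- t) * c0 * real n powr (- (real DIM('a) * real K / 2) - (real K - 1) / 2 - \<alpha> / 2)
        \<le> (\<integral>P. (\<Prod>i<n. mixture_density f P (X i) / mixture_density f Pstar (X i)) \<partial>dirichlet_process \<alpha> P0)}"
        unfolding a_eq DP .
    qed
  qed
qed

end
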